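(* Let $B$ be a Boolean $\sigma$-algebra. Then $B$ is a measure algebra if and only if $B$ is weakly distributive and there is a countable family $\{C_n\}_{n=1}^\infty$ of subsets of $B^+$ with $B^+=\bigcup_{n=1}^\infty C_n$ such that (i) for every $n$ there is an integer $K(n)$ such that every antichain contained in $C_n$ has at most $K(n)$ elements; and (ii) for every $n$ and all $a,b\in B$, if $a\cup b\in C_n$ then either $a\in C_{n+1}$ or $b\in C_{n+1}$.
   Context: A Boolean algebra $B$ is an algebra of subsets of a nonempty set $X$ with operations $a\cup b$, $a\cap b$, $-a=X-a$, zero $\mathbf 0=\emptyset$ and unit $\mathbf 1=X$ (so $\mathbf 0\neq\mathbf 1$), ordered by inclusion. $B$ is a Boolean $\sigma$-algebra if every countable $A\subset B$ has a supremum $\bigvee A$ and an infimum $\bigwedge A$ in the ordering of $B$. $B^+=B-\{\mathbf 0\}$. A measure on a Boolean $\sigma$-algebra $B$ is a real-valued function $m$ on $B$ with: $m(\mathbf 0)=0$, $m(a)>0$ for $a\ne\mathbf 0$, $m(\mathbf 1)=1$; $m(a)\le m(b)$ if $a\subset b$; $m(a\cup b)=m(a)+m(b)$ if $a\cap b=\mathbf 0$; and $m(\bigvee_{n=1}^\infty a_n)=\sum_{n=1}^\infty m(a_n)$ whenever the $a_n$ are pairwise disjoint. A measure algebra is a Boolean $\sigma$-algebra that carries a measure. An antichain is a set $A\subset B^+$ such that $a\cap b=\mathbf 0$ for all distinct $a,b\in A$. A partition (of $\mathbf 1$) is a maximal antichain, i.e. an antichain with supremum $\mathbf 1$. $B$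 is weakly distributive if for every sequence $\{W_n\}_n$ of partitions there is a partition $W$ such that each $a\in W$ meets (has nonzero intersection with) only finitely many elements of each $W_n$. *)

theory Defs
  imports "HOL-Analysis.Sigma_Algebra"
begin

text \<open>
  A Boolean algebra is an algebra of subsets \<^term>\<open>B\<close> of a nonempty set \<^term>\<open>X\<close>, given by the
  library locale \<^locale>\<open>algebra\<close>.  Suprema and infima are taken in the inclusion ordering of
  \<^term>\<open>B\<close>; they need not be unions and intersections, so a Boolean $\sigma$-algebra need not be
  a \<^locale>\<open>sigma_algebra\<close> of sets.  All sequences are indexed from 0.
\<close>

definition is_supremum :: "'a set set \<Rightarrow> 'a set set \<Rightarrow> 'a set \<Rightarrow> bool" where
  "is_supremum B A s \<longleftrightarrow>
     s \<in> B \<and> (\<forall>a\<in>A. a \<subseteq> s) \<and> (\<forall>u\<in>B. (\<forall>a\<in>A. a \<subseteq> u) \<longrightarrow> s \<subseteq> u)"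

definition is_infimum :: "'a set set \<Rightarrow> 'a set set \<Rightarrow> 'a set \<Rightarrow> bool" where
  "is_infimum B A i \<longleftrightarrow>
     i \<in> B \<and> (\<forall>a\<in>A. i \<subseteq> a) \<and> (\<forall>l\<in>B. (\<forall>a\<in>A. l \<subseteq> a) \<longrightarrow> l \<subseteq> i)"

definition boolean_algebra_of_sets :: "'a set \<Rightarrow> 'a set set \<Rightarrow> bool" where
  "boolean_algebra_of_sets X B \<longleftrightarrow> X \<noteq> {} \<and> algebra X B"

definition boolean_sigma_algebra :: "'a set \<Rightarrow> 'a set set \<Rightarrow> bool" where
  "boolean_sigma_algebra X B \<longleftrightarrow>
     boolean_algebra_of_sets X B \<and>
     (\<forall>A. A \<subseteq> B \<and> countable A \<longrightarrow> (\<exists>s. is_supremum B A s) \<and> (\<exists>i. is_infimum B A i))"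

definition positive_elements :: "'a set set \<Rightarrow> 'a set set" where
  "positive_elements B = B - {{}}"

text \<open>Only the values of \<^term>\<open>m\<close> on \<^term>\<open>B\<close> matter.\<close>

definition boolean_measure :: "'a set \<Rightarrow> 'a set set \<Rightarrow> ('a set \<Rightarrow> real) \<Rightarrow> bool" where
  "boolean_measure X B m \<longleftrightarrow>
     m {} = 0 \<and> (\<forall>a\<in>B. a \<noteq> {} \<longrightarrow> m a > 0) \<and> m X = 1 \<and>
     (\<forall>a\<in>B. \<forall>b\<in>B. a \<subseteq> b \<longrightarrow> m a \<le> m b) \<and>
     (\<forall>a\<in>B. \<forall>b\<in>B. a \<inter> b = {} \<longrightarrow> m (a \<union> b) = m a + m b) \<and>
     (\<forall>(a :: nat \<Rightarrow> 'a set) s. range a \<subseteq> B \<and> disjoint_family a \<and> is_supremum B (range a) s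
        \<longrightarrow> (\<lambda>n. m (a n)) sums m s)"

definition measure_algebra :: "'a set \<Rightarrow> 'a set set \<Rightarrow> bool" where
  "measure_algebra X B \<longleftrightarrow> boolean_sigma_algebra X B \<and> (\<exists>m. boolean_measure X B m)"

definition antichain :: "'a set set \<Rightarrow> 'a set set \<Rightarrow> bool" where
  "antichain B A \<longleftrightarrow>
     A \<subseteq> positive_elements B \<and> (\<forall>a\<in>A. \<forall>b\<in>A. a \<noteq> b \<longrightarrow> a \<inter> b = {})"

definition partition_of_unit :: "'a set set \<Rightarrow> 'a set set \<Rightarrow> bool" where
  "partition_of_unit B W \<longleftrightarrow>
     antichain B W \<and> (\<forall>A. antichain B A \<and> W \<subseteq> A \<longrightarrow> A = W)"

lemma partition_of_unit_iff_supremum: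
  assumes "boolean_algebra_of_sets X B"
  shows "partition_of_unit B W \<longleftrightarrow> antichain B W \<and> is_supremum B W X"
proof -
  interpret algebra X B using assms by (simp add: boolean_algebra_of_sets_def)
  have sup: "X \<subseteq> u" if W: "partition_of_unit B W" and u: "u \<in> B" "\<forall>a\<in>W. a \<subseteq> u" for u
  proof (rule ccontr)
    assume "\<not> X \<subseteq> u"
    then have ne: "X - u \<noteq> {}" by blast
    have "antichain B (insert (X - u) W)"
      using W u ne unfolding partition_of_unit_def antichain_def positive_elements_def by auto
    then have "insert (X - u) W = W"
      using W by (auto simp: partition_of_unit_def)
    then have "X - u \<in> W" by blast
    then show False using u ne by blast
  qed
  have max: "A = W" if W: "antichain B W" "is_supremum B W X" and A: "antichain B A" "W \<subseteq> A" for A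
  proof (rule ccontr)
    assume "A \<noteq> W"
    then obtain c where c: "c \<in> A" "c \<notin> W" using A by blast
    have cB: "c \<in> B" "c \<noteq> {}" using c A by (auto simp: antichain_def positive_elements_def)
    have "\<forall>a\<in>W. a \<subseteq> X - c"
    proof
      fix a assume "a \<in> W"
      with c A have "a \<in> A" "a \<noteq> c" by auto
      with c(1) A(1) have "a \<inter> c = {}" "a \<in> B"
        by (auto simp: antichain_def positive_elements_def)
      then show "a \<subseteq> X - c" using sets_into_space[of a] by blast
    qed
    moreover have "X - c \<in> B" using cB by blast
    ultimately have "X \<subseteq> X - c" using W(2) by (simp add: is_supremum_def)
    then show False using cB sets_into_space[of c] by blast
  qed
  show ?thesis
  proof
    assume W: "partition_of_unit B W"
    then have "antichain B W" by (simp add: partition_of_unit_def)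
    moreover have "\<forall>a\<in>W. a \<subseteq> X"
      using \<open>antichain B W\<close> sets_into_space by (auto simp: antichain_def positive_elements_def)
    ultimately show "antichain B W \<and> is_supremum B W X"
      using sup[OF W] top by (simp add: is_supremum_def)
  next
    assume "antichain B W \<and> is_supremum B W X"
    then show "partition_of_unit B W" using max by (simp add: partition_of_unit_def)
  qed
qed

definition weakly_distributive :: "'a set set \<Rightarrow> bool" where
  "weakly_distributive B \<longleftrightarrow>
     (\<forall>W :: nat \<Rightarrow> 'a set set. (\<forall>n. partition_of_unit B (W n)) \<longrightarrow>
        (\<exists>V. partition_of_unit B V \<and> (\<forall>a\<in>V. \<forall>n. finite {w \<in> W n. a \<inter> w \<noteq> {}})))"

end

theory Submission
  imports Defs "HOL-Analysis.Analysis"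
begin

text \<open>
  Given a measure \<open>m\<close>, take \<open>C\<^sub>n = {a. m a \<ge> 2\<^sup>-\<^sup>n}\<close>; weak distributivity
  holds because finite parts of the \<open>n\<close>-th partition leave out arbitrarily little measure.

  Conversely, the combinatorial core of the Kalton--Roberts theorem applies to the \<open>C\<^sub>n\<close>
  directly, without a submeasure: two applications of (ii) show that splitting an element of
  \<open>C\<^sub>n\<close> into four parts leaves one part in \<open>C\<^sub>n\<^sub>+\<^sub>2\<close>, whose antichains are bounded, and a
  concentrator then gives \<open>C\<^sub>n\<close> a positive intersection number.  By Kelley's argument some
  finitely additive probability is bounded away from 0 on \<open>C\<^sub>n\<close>.  A weighted sum of
  these is a strictly positive charge, and under weak distributivity its countably additive part
  is still strictly positive.
\<close>

section \<open>Concentrators\<close>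

text \<open>The number four ties two things together. Condition (ii), used twice, handles four
  parts, and a bipartite graph of degree 4 assigns to the sets containing a given point pairwise
  different labels, the label of a set being one of its four neighbours; which neighbour is used
  decides the part to which the point goes. Parts with a common label are then disjoint. Degree 4
  with expansion 2 suits a random graph: the union bound involves only
  \<open>m * e / l\<^sup>2\<close>, so the ratio of sets to labels may be as large as desired if
  each point lies in a small enough share of the sets.

  All this yields finite additivity only, which is not enough: the Cohen algebra has a strictly
  positive charge, hence such sets \<open>C n\<close>, but no measure. Another obstacle is that
  suprema in \<open>B\<close> need not be unions. Points of \<open>X\<close> therefore serve for
  finite Boolean combinations, where charges are averages of point masses, while the countable part
  replaces inclusion in a union by \<open>covers\<close>.\<close>

lemma power_self_le_fact: "real n ^ n \<le> 3 ^ n * fact n"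
proof -
  have "real n ^ n / fact n = (\<Sum>i\<in>{n}. inverse (fact i) * real n ^ i)"
    by (simp add: field_simps)
  also have "\<dots> \<le> (\<Sum>i. inverse (fact i) * real n ^ i)"
    by (rule sum_le_suminf) (auto simp: summable_exp)
  also have "\<dots> = exp (real n)"
    by (simp add: exp_def scaleR_conv_of_real)
  also have "\<dots> = exp 1 ^ n"
    by (simp flip: exp_of_nat_mult)
  also have "\<dots> \<le> 3 ^ n"
    using exp_le by (intro power_mono) auto
  finally show ?thesis
    by (simp add: field_simps)
qed

text \<open>This is the union bound for a random map. There are \<open>m choose e\<close> sources
  and \<open>l choose (2 * e)\<close> targets, and all \<open>4 * e\<close> values hit the target
  with probability \<open>(2 * e / l) ^ (4 * e)\<close>; the expected number of such pairs is to be
  at most \<open>1 / 2 ^ e\<close>. Cancelling leaves the \<open>e\<close>-th power of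
  \<open>216 * m * e / l\<^sup>2\<close>, where 216 is 4 from \<open>(2 * e)\<^sup>2\<close>, times
  2 from \<open>2 ^ e\<close>, times 27 from trading the two factorials for powers.\<close>

lemma expansion_count_le:
  fixes e k l m :: nat
  assumes "0 < e" "e \<le> k" "216 * m * k \<le> l\<^sup>2"
  shows "real (m choose e) * real (l choose (2 * e)) * real (2 * e) ^ (4 * e) * 2 ^ e \<le> real l ^ (4 * e)"
proof -
  have A: "real (m choose e) * fact e \<le> real m ^ e"
    using binomial_fact_pow[of m e] by (metis of_nat_fact of_nat_le_iff of_nat_mult of_nat_power)
  have B: "real (l choose (2 * e)) * fact (2 * e) \<le> real l ^ (2 * e)"
    using binomial_fact_pow[of l "2 * e"] by (metis of_nat_fact of_nat_le_iff of_nat_mult of_nat_power)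
  have sq: "real (2 * e) ^ (4 * e) = real (2 * e) ^ (2 * e) * real (2 * e) ^ (2 * e)"
    by (subst power_add[symmetric]) (rule arg_cong[where f = "power _"], simp)
  \<comment> \<open>The extra factor \<open>real e ^ e\<close> supplies, next to
    \<open>(2 * e) ^ (2 * e)\<close>, the second power that is traded for a factorial; it is
    cancelled at the end.\<close>
  have "real (m choose e) * real (l choose (2 * e)) * real (2 * e) ^ (4 * e) * 2 ^ e * real e ^ e
      = real (m choose e) * real (l choose (2 * e)) * real (2 * e) ^ (2 * e) * 2 ^ e * (real e ^ e * real (2 * e) ^ (2 * e))"
    unfolding sq by (simp only: mult_ac)
  also have "\<dots> \<le> real (m choose e) * real (l choose (2 * e)) * real (2 * e) ^ (2 * e) * 2 ^ e
      * ((3 ^ e * fact e) * (3 ^ (2 * e) * fact (2 * e)))"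
    by (intro mult_left_mono mult_mono power_self_le_fact) auto
  also have "\<dots> = (real (m choose e) * fact e) * (real (l choose (2 * e)) * fact (2 * e))
      * (real (2 * e) ^ (2 * e) * 2 ^ e * 3 ^ e * 3 ^ (2 * e))"
    by (simp only: mult_ac)
  also have "\<dots> \<le> real m ^ e * real l ^ (2 * e) * (real (2 * e) ^ (2 * e) * 2 ^ e * 3 ^ e * 3 ^ (2 * e))"
    by (intro mult_right_mono mult_mono A B) auto
  also have "\<dots> = (real m * real l ^ 2 * (real (2 * e) ^ 2 * 2 * 3 * 3 ^ 2)) ^ e"
    by (simp only: power_mult_distrib power_mult[symmetric])
  also have "real m * real l ^ 2 * (real (2 * e) ^ 2 * 2 * 3 * 3 ^ 2) = real l ^ 2 * real (216 * m * e) * real e"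
    by (simp add: power2_eq_square)
  also have "(real l ^ 2 * real (216 * m * e) * real e) ^ e \<le> (real l ^ 2 * real l ^ 2 * real e) ^ e"
  proof (intro power_mono mult_right_mono mult_left_mono)
    have "216 * m * e \<le> l\<^sup>2"
      using assms by (meson le_trans mult_le_mono2)
    then show "real (216 * m * e) \<le> real l ^ 2"
      by (metis of_nat_le_iff of_nat_power)
  qed auto
  also have "\<dots> = real l ^ (4 * e) * real e ^ e"
    by (simp add: power_mult_distrib power_mult[symmetric] flip: power_add)
  finally show ?thesis
    using assms(1) by simp
qed

text \<open>A random map has this property: the first moment of the number of pairs \<^term>\<open>(E, D)\<close> with
  \<^term>\<open>card D = 2 * card E\<close> and \<^term>\<open>g ` (E \<times> {..<4}) \<subseteq> D\<close> is less than 1.\<close>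

lemma expanding_map_exists:
  fixes M :: "'b set" and L :: "'c set"
  assumes fin: "finite M" "finite L" and k: "0 < k" "2 * k \<le> card L"
    and le: "216 * card M * k \<le> (card L)\<^sup>2"
  obtains g :: "'b \<times> nat \<Rightarrow> 'c" where "g \<in> M \<times> {..<4} \<rightarrow> L"
    and "\<And>E. E \<subseteq> M \<Longrightarrow> E \<noteq> {} \<Longrightarrow> card E \<le> k \<Longrightarrow> 2 * card E < card (g ` (E \<times> {..<4}))"
proof -
  define m l where "m = card M" and "l = card L"
  define T where "T = (M \<times> {..<4::nat}) \<rightarrow>\<^sub>E L"
  define Bad where "Bad E D = {g \<in> T. g ` (E \<times> {..<4}) \<subseteq> D}" for E D
  define Es where "Es e = {E. E \<subseteq> M \<and> card E = e}" for e
  define Ds where "Ds e = {D. D \<subseteq> L \<and> card D = 2 * e}" for e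
  define U where "U = (\<Union>e\<in>{1..k}. \<Union>E\<in>Es e. \<Union>D\<in>Ds e. Bad E D)"
  have l0: "0 < l" using k by (simp add: l_def)
  have finT: "finite T" using fin by (auto simp: T_def intro!: finite_PiE)
  have cardT: "card T = l ^ (4 * m)"
    using fin by (simp add: T_def card_PiE card_cartesian_product l_def m_def mult.commute)
  have finEs: "finite (Es e)" "finite (Ds e)" for e
    using fin by (auto simp: Es_def Ds_def)
  \<comment> \<open>The probability \<open>(2 * e / l) ^ (4 * e)\<close> with denominators cleared,
    which avoids the truncated difference \<open>m - e\<close> in later steps.\<close>
  have cardBad: "real (card (Bad E D)) * real l ^ (4 * e) = real (2 * e) ^ (4 * e) * real l ^ (4 * m)"
    if "E \<in> Es e" "D \<in> Ds e" for e E D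
  proof -
    have E: "E \<subseteq> M" "card E = e" "finite E" and D: "D \<subseteq> L" "card D = 2 * e"
      using that fin by (auto simp: Es_def Ds_def intro: finite_subset)
    have "Bad E D = (\<Pi>\<^sub>E p \<in> M \<times> {..<4::nat}. if p \<in> E \<times> {..<4::nat} then D else L)"
    proof (intro set_eqI iffI)
      fix g assume "g \<in> (\<Pi>\<^sub>E p \<in> M \<times> {..<4::nat}. if p \<in> E \<times> {..<4::nat} then D else L)"
      then have ext: "g \<in> extensional (M \<times> {..<4::nat})"
        and g: "\<And>p. p \<in> M \<times> {..<4::nat} \<Longrightarrow> g p \<in> (if p \<in> E \<times> {..<4::nat} then D else L)"
        by (auto simp only: PiE_iff)
      have "g p \<in> L" if "p \<in> M \<times> {..<4::nat}" for p
        using g[OF that] D by (auto split: if_splits)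
      moreover have "g p \<in> D" if "p \<in> E \<times> {..<4::nat}" for p
        using g[of p] E that by auto
      ultimately show "g \<in> Bad E D"
        using ext by (auto simp: Bad_def T_def PiE_iff)
    qed (auto simp: Bad_def T_def PiE_iff)
    then have "card (Bad E D) = (\<Prod>p\<in>M \<times> {..<4::nat}. if p \<in> E \<times> {..<4::nat} then 2 * e else l)"
      using fin D by (simp add: card_PiE l_def if_distrib cong: if_cong)
    also have "\<dots> = (\<Prod>p\<in>E \<times> {..<4::nat}. 2 * e) * (\<Prod>p\<in>(M - E) \<times> {..<4::nat}. l)"
    proof -
      let ?h = "\<lambda>p. if p \<in> E \<times> {..<4::nat} then 2 * e else l"
      have *: "M \<times> {..<4::nat} = E \<times> {..<4} \<union> (M - E) \<times> {..<4}" using E by auto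
      have "prod ?h (M \<times> {..<4}) = prod ?h (E \<times> {..<4}) * prod ?h ((M - E) \<times> {..<4})"
        unfolding * using fin E by (intro prod.union_disjoint) auto
      also have "\<dots> = (\<Prod>p\<in>E \<times> {..<4::nat}. 2 * e) * (\<Prod>p\<in>(M - E) \<times> {..<4::nat}. l)"
        by (intro arg_cong2[where f = "(*)"] prod.cong) auto
      finally show ?thesis .
    qed
    also have "\<dots> = (2 * e) ^ (4 * e) * l ^ (4 * (m - e))"
      using E fin by (simp add: card_cartesian_product card_Diff_subset m_def mult.commute)
    finally have c: "card (Bad E D) = (2 * e) ^ (4 * e) * l ^ (4 * (m - e))" .
    have "e \<le> m" using E fin by (auto simp: m_def intro: card_mono)
    then have "real l ^ (4 * (m - e)) * real l ^ (4 * e) = real l ^ (4 * m)"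
      by (subst power_add[symmetric]) (simp add: diff_mult_distrib2)
    then show ?thesis by (simp add: c)
  qed
  have "real (card U) \<le> (\<Sum>e\<in>{1..k}. real l ^ (4 * m) * (1/2) ^ e)"
  proof -
    have "real (card (\<Union>E\<in>Es e. \<Union>D\<in>Ds e. Bad E D)) \<le> real l ^ (4 * m) * (1/2) ^ e" if e: "e \<in> {1..k}" for e
    proof -
      let ?b = "real (2 * e) ^ (4 * e) * real l ^ (4 * m) / real l ^ (4 * e)"
      have b: "real (card (Bad E D)) = ?b" if "E \<in> Es e" "D \<in> Ds e" for E D
        using cardBad[OF that] l0 by (simp add: field_simps)
      have "card (\<Union>E\<in>Es e. \<Union>D\<in>Ds e. Bad E D) \<le> (\<Sum>E\<in>Es e. \<Sum>D\<in>Ds e. card (Bad E D))"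
        by (intro order_trans[OF card_UN_le] sum_mono card_UN_le finEs)
      then have "real (card (\<Union>E\<in>Es e. \<Union>D\<in>Ds e. Bad E D)) \<le> real (\<Sum>E\<in>Es e. \<Sum>D\<in>Ds e. card (Bad E D))"
        by (rule of_nat_mono)
      also have "\<dots> = (\<Sum>E\<in>Es e. \<Sum>D\<in>Ds e. ?b)"
        unfolding of_nat_sum by (intro sum.cong refl b)
      also have "\<dots> = real (m choose e) * (real (l choose (2 * e)) * ?b)"
        using fin by (simp add: n_subsets Es_def Ds_def m_def l_def)
      also have "\<dots> = (real (m choose e) * real (l choose (2 * e)) * real (2 * e) ^ (4 * e) * 2 ^ e)
          * (real l ^ (4 * m) / real l ^ (4 * e)) * (1/2) ^ e"
        by (simp add: power_one_over)
      also have "\<dots> \<le> real l ^ (4 * e) * (real l ^ (4 * m) / real l ^ (4 * e)) * (1/2) ^ e"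
        using e le by (intro mult_right_mono expansion_count_le[of e k]) (auto simp: m_def l_def)
      also have "\<dots> = real l ^ (4 * m) * (1/2) ^ e"
        using l0 by simp
      finally show ?thesis .
    qed
    then have "(\<Sum>e\<in>{1..k}. real (card (\<Union>E\<in>Es e. \<Union>D\<in>Ds e. Bad E D))) \<le> (\<Sum>e\<in>{1..k}. real l ^ (4 * m) * (1/2) ^ e)"
      by (rule sum_mono)
    moreover have "real (card U) \<le> real (\<Sum>e\<in>{1..k}. card (\<Union>E\<in>Es e. \<Union>D\<in>Ds e. Bad E D))"
      unfolding U_def by (intro of_nat_mono card_UN_le) auto
    ultimately show ?thesis by simp
  qed
  also have "\<dots> = real l ^ (4 * m) * (\<Sum>e\<in>{1..k}. (1/2) ^ e)"
    by (simp add: sum_distrib_left)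
  also have "(\<Sum>e\<in>{1..k}. (1/2::real) ^ e) = 1 - (1/2) ^ k"
    by (induction k) auto
  also have "real l ^ (4 * m) * (1 - (1/2) ^ k) < real l ^ (4 * m)"
    using l0 by (simp add: algebra_simps)
  finally have "card U < card T"
    unfolding cardT by (metis of_nat_less_iff of_nat_power)
  moreover have "finite U"
    using finT by (rule finite_subset[rotated]) (auto simp: U_def Bad_def)
  ultimately have "\<not> T \<subseteq> U"
    using card_mono[of U T] by linarith
  then obtain g where g: "g \<in> T" "g \<notin> U" by blast
  show ?thesis
  proof (rule that[of g])
    show "g \<in> M \<times> {..<4} \<rightarrow> L" using g(1) by (auto simp: T_def PiE_iff)
    fix E assume E: "E \<subseteq> M" "E \<noteq> {}" "card E \<le> k"
    then have "finite E" using fin by (auto intro: finite_subset)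
    show "2 * card E < card (g ` (E \<times> {..<4}))"
    proof (rule ccontr)
      assume "\<not> 2 * card E < card (g ` (E \<times> {..<4}))"
      moreover have "g ` (E \<times> {..<4}) \<subseteq> L" using E g(1) by (auto simp: T_def PiE_iff)
      \<comment> \<open>\<open>Ds\<close> holds sets of size exactly \<open>2 * e\<close>, so a
        smaller image is padded inside \<open>L\<close>; this is where
        \<open>2 * k \<le> card L\<close> enters.\<close>
      ultimately obtain D where "g ` (E \<times> {..<4}) \<subseteq> D" "D \<subseteq> L" "card D = 2 * card E"
        using exists_subset_between[of "g ` (E \<times> {..<4})" "2 * card E" L] E k fin by auto
      moreover have "card E \<in> {1..k}" using E \<open>finite E\<close> by (auto simp: Suc_le_eq card_gt_0_iff)
      ultimately have "g \<in> U"
        using g(1) E unfolding U_def Es_def Ds_def Bad_def by blast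
      with g(2) show False ..
    qed
  qed
qed

text \<open>Expansion by more than half the degree yields a point with a unique neighbour; match it
  and remove it.\<close>

lemma expanding_imp_matching:
  fixes g :: "'b \<times> nat \<Rightarrow> 'c"
  assumes "finite E" "\<And>E'. E' \<subseteq> E \<Longrightarrow> E' \<noteq> {} \<Longrightarrow> 2 * card E' < card (g ` (E' \<times> {..<4}))"
  shows "\<exists>f \<in> E \<rightarrow> {..<4}. inj_on (\<lambda>i. g (i, f i)) E"
  using assms
proof (induction E rule: finite_psubset_induct)
  case (psubset E)
  show ?case
  proof (cases "E = {}")
    case True
    then show ?thesis by auto
  next
    case False
    let ?P = "E \<times> {..<4::nat}"
    have "\<exists>y \<in> g ` ?P. card {p \<in> ?P. g p = y} < 2"
    proof (rule ccontr)
      assume "\<not> ?thesis"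
      then have "(\<Sum>y\<in>g ` ?P. 2) \<le> (\<Sum>y\<in>g ` ?P. card {p \<in> ?P. g p = y})"
        by (intro sum_mono) (force simp: not_less)
      also have "\<dots> = card ?P"
        using sum.image_gen[of ?P "\<lambda>_. 1::nat" g] psubset.hyps by simp
      also have "\<dots> = 4 * card E" by (simp add: card_cartesian_product)
      finally show False using psubset.prems[of E] False by simp
    qed
    then obtain i c where ic: "i \<in> E" "c < 4" "card {p \<in> ?P. g p = g (i, c)} < 2" by auto
    have uniq: "p = (i, c)" if "p \<in> ?P" "g p = g (i, c)" for p
    proof (rule ccontr)
      assume "p \<noteq> (i, c)"
      then have "card {p, (i, c)} = 2" by simp
      moreover have "card {p, (i, c)} \<le> card {p \<in> ?P. g p = g (i, c)}"
        using that ic psubset.hyps by (intro card_mono) auto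
      ultimately show False using ic by simp
    qed
    obtain f where f: "f \<in> E - {i} \<rightarrow> {..<4}" "inj_on (\<lambda>i. g (i, f i)) (E - {i})"
      using psubset.IH[of "E - {i}"] psubset.prems ic by blast
    have "inj_on (\<lambda>i'. g (i', (f(i := c)) i')) E"
    proof (rule inj_onI)
      fix x y assume xy: "x \<in> E" "y \<in> E" "g (x, (f(i := c)) x) = g (y, (f(i := c)) y)"
      have *: "g (z, f z) \<noteq> g (i, c)" if "z \<in> E" "z \<noteq> i" for z
        using uniq[of "(z, f z)"] f(1) that by auto
      show "x = y"
        using xy * f(2) by (cases "x = i"; cases "y = i") (auto dest: inj_onD)
    qed
    moreover have "f(i := c) \<in> E \<rightarrow> {..<4}" using f ic by auto
    ultimately show ?thesis by blast
  qed
qed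

section \<open>Intersection numbers and finitely additive probabilities\<close>

text \<open>Kalton and Roberts: were every point in few of the sets, a concentrator would distribute
  four-part splittings of the sets into few antichains.\<close>

lemma (in algebra) bounded_antichains_imp_intersection_number:
  fixes a :: "'b \<Rightarrow> 'a set"
  assumes C: "C \<subseteq> M"
    and D: "\<And>A. antichain M A \<Longrightarrow> A \<subseteq> D \<Longrightarrow> finite A \<and> card A \<le> K"
    and D_pos: "D \<subseteq> positive_elements M"
    and split: "\<And>h :: nat \<Rightarrow> 'a set. h ` {..<4} \<subseteq> M \<Longrightarrow> (\<Union>c<4. h c) \<in> C \<Longrightarrow> \<exists>c<4. h c \<in> D"
    and I: "finite I" "I \<noteq> {}" "a ` I \<subseteq> C"
  shows "\<exists>x\<in>\<Omega>. card I \<le> 216 * (K + 1)\<^sup>2 * card {i \<in> I. x \<in> a i}"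
proof (rule ccontr)
  assume "\<not> ?thesis"
  then have few: "216 * (K + 1)\<^sup>2 * card {i \<in> I. x \<in> a i} \<le> card I" if "x \<in> \<Omega>" for x
    using that by (auto simp: not_le intro: less_imp_le)
  define k q where "k = card I" and "q = K + 1"
  \<comment> \<open>Each index is repeated \<open>216 * q\<^sup>2\<close> times, so that
    \<open>few\<close> says that a point lies in at most \<open>k\<close> members of the enlarged
    family. The sizes make \<open>216 * card J * k\<close> equal to \<open>(card L)\<^sup>2\<close>,
    as the expanding map requires, and \<open>card J = q * card L\<close> exceeds
    \<open>K * card L\<close>, as the final pigeonhole requires.\<close>
  define J L where "J = I \<times> {..<216 * q\<^sup>2}" and "L = {..<216 * q * k}"
  define Ex where "Ex x = {p \<in> J. x \<in> a (fst p)}" for x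
  have k0: "0 < k" using I by (auto simp: k_def card_gt_0_iff)
  have finJ: "finite J" using I by (simp add: J_def)
  have cardJ: "card J = 216 * q\<^sup>2 * k" by (simp add: J_def card_cartesian_product k_def)
  have cardL: "card L = 216 * q * k" by (simp add: L_def)
  have cardEx: "card (Ex x) \<le> k" if "x \<in> \<Omega>" for x
  proof -
    have "Ex x = {i \<in> I. x \<in> a i} \<times> {..<216 * q\<^sup>2}"
      by (auto simp: Ex_def J_def)
    then have "card (Ex x) = 216 * q\<^sup>2 * card {i \<in> I. x \<in> a i}"
      by (simp only: card_cartesian_product card_lessThan mult.commute)
    then show ?thesis using few[OF that] by (simp add: k_def q_def)
  qed
  have ExJ: "Ex x \<subseteq> J" for x by (auto simp: Ex_def)
  have "2 * k \<le> card L" using k0 by (simp add: cardL q_def)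
  moreover have "216 * card J * k \<le> (card L)\<^sup>2"
    by (simp add: cardJ cardL power2_eq_square)
  ultimately obtain g :: "('b \<times> nat) \<times> nat \<Rightarrow> nat" where gL: "g \<in> J \<times> {..<4} \<rightarrow> L"
    and exp: "\<And>E. E \<subseteq> J \<Longrightarrow> E \<noteq> {} \<Longrightarrow> card E \<le> k \<Longrightarrow> 2 * card E < card (g ` (E \<times> {..<4}))"
    using expanding_map_exists[of J L k] finJ k0 unfolding L_def by blast
  have "\<exists>f \<in> E \<rightarrow> {..<4}. inj_on (\<lambda>i. g (i, f i)) E" if "E \<subseteq> J" "card E \<le> k" for E
  proof (rule expanding_imp_matching)
    show "finite E" using that finJ finite_subset by blast
    then show "2 * card E' < card (g ` (E' \<times> {..<4}))" if "E' \<subseteq> E" "E' \<noteq> {}" for E'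
      using exp[of E'] that \<open>E \<subseteq> J\<close> \<open>card E \<le> k\<close> card_mono[of E E'] by auto
  qed
  then obtain F where F: "\<And>E. E \<subseteq> J \<Longrightarrow> card E \<le> k \<Longrightarrow> F E \<in> E \<rightarrow> {..<4} \<and> inj_on (\<lambda>i. g (i, F E i)) E"
    by metis
  \<comment> \<open>At a point \<open>x\<close> the matching for the set \<open>Ex x\<close> picks a
    neighbour for every index whose set contains \<open>x\<close>; \<open>b p c\<close> collects the
    points at which \<open>p\<close> uses its neighbour number \<open>c\<close>. It belongs to
    \<open>M\<close> because \<open>Ex x\<close> takes finitely many values, each on a set of
    \<open>M\<close>.\<close>
  define b where "b p c = {x \<in> \<Omega>. p \<in> Ex x \<and> F (Ex x) p = c}" for p c
  have aM: "a i \<in> M" "a i \<subseteq> \<Omega>" if "i \<in> I" for i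
    using that I C sets_into_space by auto
  have bM: "b p c \<in> M" for p c
  proof -
    have atom: "{x \<in> \<Omega>. Ex x = E} \<in> M" if "E \<subseteq> J" for E
    proof -
      have "{x \<in> \<Omega>. Ex x = E} = {x \<in> \<Omega>. \<forall>p\<in>J. x \<in> (if p \<in> E then a (fst p) else \<Omega> - a (fst p))}"
        using that by (auto simp: Ex_def split: if_splits)
      also have "\<dots> \<in> M"
      proof (rule sets_Collect_finite_All[OF _ finJ])
        fix p assume "p \<in> J"
        then have "a (fst p) \<in> M" using aM by (auto simp: J_def)
        then have "{x \<in> \<Omega>. x \<in> a (fst p)} = a (fst p)" "{x \<in> \<Omega>. x \<in> \<Omega> - a (fst p)} = \<Omega> - a (fst p)"
          using sets_into_space by auto
        with \<open>a (fst p) \<in> M\<close> show "{x \<in> \<Omega>. x \<in> (if p \<in> E then a (fst p) else \<Omega> - a (fst p))} \<in> M"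
          by auto
      qed
      finally show ?thesis .
    qed
    have "b p c = (\<Union>E\<in>{E \<in> Pow J. p \<in> E \<and> F E p = c}. {x \<in> \<Omega>. Ex x = E})"
      using ExJ by (auto simp: b_def)
    also have "\<dots> \<in> M"
      using finJ by (intro finite_UN) (auto intro: atom)
    finally show ?thesis .
  qed
  have "\<exists>c<4. b p c \<in> D" if "p \<in> J" for p
  proof (rule split)
    have "a (fst p) = (\<Union>c<4. b p c)"
    proof (intro set_eqI iffI)
      fix x assume x: "x \<in> a (fst p)"
      then have "x \<in> \<Omega>" "p \<in> Ex x" using that aM(2)[of "fst p"] by (auto simp: J_def Ex_def)
      then have "F (Ex x) p < 4" using F[of "Ex x"] cardEx[of x] by (auto simp: Ex_def)
      with \<open>x \<in> \<Omega>\<close> \<open>p \<in> Ex x\<close> show "x \<in> (\<Union>c<4. b p c)" by (auto simp: b_def)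
    qed (auto simp: b_def Ex_def)
    then show "(\<Union>c<4. b p c) \<in> C" using that I by (auto simp: J_def)
    show "b p ` {..<4} \<subseteq> M" using bM by blast
  qed
  then obtain c where c: "\<And>p. p \<in> J \<Longrightarrow> c p < 4" "\<And>p. p \<in> J \<Longrightarrow> b p (c p) \<in> D" by metis
  \<comment> \<open>If two selected parts shared a point, the matching at that point would give
    their indices different values of \<open>j\<close>. Hence each fibre of \<open>j\<close>
    produces an antichain inside \<open>D\<close>, and a fibre with more than \<open>K\<close>
    elements is contradictory.\<close>
  define j where "j p = g (p, c p)" for p
  have "\<exists>y\<in>L. K < card {p \<in> J. j p = y}"
  proof (rule ccontr)
    assume "\<not> ?thesis"
    then have le: "card {p \<in> J. j p = y} \<le> K" if "y \<in> L" for y using that by (auto simp: not_less)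
    have "j ` J \<subseteq> L" using gL c(1) by (auto simp: j_def)
    have "card J = (\<Sum>y\<in>j ` J. card {p \<in> J. j p = y})"
      using sum.image_gen[of J "\<lambda>_. 1::nat" j] finJ by simp
    also have "\<dots> \<le> (\<Sum>y\<in>j ` J. K)"
      using \<open>j ` J \<subseteq> L\<close> le by (intro sum_mono) auto
    also have "\<dots> \<le> card L * K"
      using card_mono[OF _ \<open>j ` J \<subseteq> L\<close>] by (simp add: L_def)
    also have "\<dots> < card J"
      using k0 by (simp add: cardL cardJ q_def power2_eq_square algebra_simps)
    finally show False by simp
  qed
  then obtain y where y: "K < card {p \<in> J. j p = y}" by blast
  let ?P = "{p \<in> J. j p = y}"
  have disj: "b p (c p) \<inter> b p' (c p') = {}" if "p \<in> ?P" "p' \<in> ?P" "p \<noteq> p'" for p p'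
  proof (rule ccontr)
    assume "b p (c p) \<inter> b p' (c p') \<noteq> {}"
    then obtain x where x: "x \<in> \<Omega>" "p \<in> Ex x" "p' \<in> Ex x" "F (Ex x) p = c p" "F (Ex x) p' = c p'"
      by (auto simp: b_def)
    then have "inj_on (\<lambda>i. g (i, F (Ex x) i)) (Ex x)"
      using F[of "Ex x"] cardEx[of x] by (auto simp: Ex_def)
    with x that show False by (auto simp: inj_on_def j_def)
  qed
  have ne: "b p (c p) \<noteq> {}" if "p \<in> ?P" for p
    using c(2)[of p] that D_pos by (auto simp: positive_elements_def)
  let ?A = "(\<lambda>p. b p (c p)) ` ?P"
  have "inj_on (\<lambda>p. b p (c p)) ?P"
  proof (intro inj_onI, rule ccontr)
    fix p p' assume p: "p \<in> ?P" "p' \<in> ?P" and "b p (c p) = b p' (c p')" "p \<noteq> p'"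
    then show False using disj[OF p] ne[OF p(1)] by simp
  qed
  then have "card ?A = card ?P" by (rule card_image)
  moreover have "antichain M ?A"
    unfolding antichain_def
  proof (intro conjI ballI impI)
    show "?A \<subseteq> positive_elements M"
      using ne bM by (simp add: positive_elements_def image_subset_iff)
    fix u v assume "u \<in> ?A" "v \<in> ?A" "u \<noteq> v"
    then obtain p p' where "p \<in> ?P" "p' \<in> ?P" "u = b p (c p)" "v = b p' (c p')" by blast
    moreover from this \<open>u \<noteq> v\<close> have "p \<noteq> p'" by blast
    ultimately show "u \<inter> v = {}" using disj by simp
  qed
  moreover have "?A \<subseteq> D" using c(2) by blast
  ultimately show False
    using D[of ?A] y by linarith
qed

section \<open>From intersection numbers to finitely additive probabilities\<close>

definition normalized_charges :: "'a set \<Rightarrow> 'a set set \<Rightarrow> ('a set \<Rightarrow> real) set" where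
  "normalized_charges X B =
     {\<mu>. (\<forall>a. 0 \<le> \<mu> a \<and> \<mu> a \<le> 1) \<and> \<mu> X = 1 \<and>
          (\<forall>a\<in>B. \<forall>b\<in>B. a \<inter> b = {} \<longrightarrow> \<mu> (a \<union> b) = \<mu> a + \<mu> b)}"

text \<open>Blackwell's approachability argument: always put the next unit mass at a point that does well
  against the current deficits.\<close>

lemma charge_with_small_deficit:
  fixes X :: "'a set" and F :: "'a set set" and d :: real
  assumes F: "finite F" and d: "0 \<le> d" "d \<le> 1"
    and w: "\<And>w :: 'a set \<Rightarrow> real. (\<And>a. 0 \<le> w a) \<Longrightarrow>
      \<exists>x\<in>X. d * sum w F \<le> (\<Sum>a\<in>F. w a * indicator a x)"
  shows "\<exists>N :: 'a set \<Rightarrow> real. (\<forall>a. 0 \<le> N a \<and> N a \<le> real T) \<and> N X = real T \<and>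
    (\<forall>a b. a \<inter> b = {} \<longrightarrow> N (a \<union> b) = N a + N b) \<and>
    (\<Sum>a\<in>F. (max 0 (real T * d - N a))\<^sup>2) \<le> real (card F) * real T"
proof (induction T)
  case 0
  show ?case by (rule exI[of _ "\<lambda>_. 0"]) simp
next
  case (Suc T)
  then obtain N where N: "\<And>a. 0 \<le> N a" "\<And>a. N a \<le> real T" "N X = real T"
      "\<And>a b. a \<inter> b = {} \<Longrightarrow> N (a \<union> b) = N a + N b"
      "(\<Sum>a\<in>F. (max 0 (real T * d - N a))\<^sup>2) \<le> real (card F) * real T" by blast
  define s where "s a = max 0 (real T * d - N a)" for a
  obtain x where x: "x \<in> X" "d * sum s F \<le> (\<Sum>a\<in>F. s a * indicator a x)"
    using w[of s] by (auto simp: s_def)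
  define N' where "N' a = N a + indicator a x" for a
  \<comment> \<open>Summed over \<open>F\<close>, the cross term is at most 0 by the choice of
    \<open>x\<close>. So the squared deficits grow by at most \<open>card F\<close> in each round:
    linearly in \<open>T\<close>, where a fixed rate of failure would give quadratic growth.\<close>
  have step: "(max 0 (real (Suc T) * d - N' a))\<^sup>2 \<le> (s a)\<^sup>2 + 2 * (d * s a - s a * indicator a x) + 1" for a
  proof -
    define u :: real where "u = d - indicator a x"
    have u: "\<bar>u\<bar> \<le> 1" using d by (auto simp: u_def split: split_indicator)
    have "\<bar>max 0 (real (Suc T) * d - N' a)\<bar> \<le> \<bar>s a + u\<bar>"
      by (auto simp: s_def N'_def u_def algebra_simps max_def)
    then have "(max 0 (real (Suc T) * d - N' a))\<^sup>2 \<le> (s a + u)\<^sup>2"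
      by (simp only: abs_le_square_iff)
    also have "\<dots> = (s a)\<^sup>2 + 2 * (s a * u) + u\<^sup>2"
      by (simp add: power2_sum)
    also have "u\<^sup>2 \<le> 1" using u by (simp add: abs_square_le_1)
    finally show ?thesis by (simp add: u_def algebra_simps)
  qed
  have "(\<Sum>a\<in>F. (max 0 (real (Suc T) * d - N' a))\<^sup>2)
      \<le> (\<Sum>a\<in>F. (s a)\<^sup>2 + 2 * (d * s a - s a * indicator a x) + 1)"
    by (intro sum_mono step)
  also have "\<dots> = (\<Sum>a\<in>F. (s a)\<^sup>2) + 2 * (d * sum s F - (\<Sum>a\<in>F. s a * indicator a x)) + real (card F)"
    by (simp add: sum.distrib sum_subtractf sum_distrib_left algebra_simps)
  also have "\<dots> \<le> real (card F) * real (Suc T)"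
    using x(2) N(5) by (simp add: s_def algebra_simps)
  finally have "(\<Sum>a\<in>F. (max 0 (real (Suc T) * d - N' a))\<^sup>2) \<le> real (card F) * real (Suc T)" .
  moreover have "0 \<le> N' a \<and> N' a \<le> real (Suc T)" for a
    using N(1,2)[of a] by (auto simp: N'_def split: split_indicator)
  moreover have "N' X = real (Suc T)" using N(3) x(1) by (simp add: N'_def)
  moreover have "N' (a \<union> b) = N' a + N' b" if "a \<inter> b = {}" for a b
    using N(4)[OF that] that by (auto simp: N'_def split: split_indicator)
  ultimately show ?case by blast
qed

text \<open>The charge is an average of \<open>T\<close> point masses. A deficit above
  \<open>T * d / 2\<close> has a square above \<open>T\<^sup>2 * d\<^sup>2 / 4\<close>, while all
  squares together stay below \<open>card F * T\<close>; this excludes it once \<open>T\<close>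
  reaches \<open>4 * card F / d\<^sup>2\<close>.\<close>

lemma normalized_charge_on_finite:
  fixes X :: "'a set" and F :: "'a set set" and d :: real
  assumes F: "finite F" and d: "0 < d" "d \<le> 1"
    and w: "\<And>w :: 'a set \<Rightarrow> real. (\<And>a. 0 \<le> w a) \<Longrightarrow>
      \<exists>x\<in>X. d * sum w F \<le> (\<Sum>a\<in>F. w a * indicator a x)"
  shows "\<exists>\<mu> \<in> normalized_charges X B. \<forall>a\<in>F. d / 2 \<le> \<mu> a"
proof -
  obtain T :: nat where T: "max 1 (4 * real (card F) / d\<^sup>2) \<le> real T"
    using real_arch_simple by blast
  then have T0: "0 < real T" and "4 * real (card F) / d\<^sup>2 \<le> real T"
    by simp_all
  then have T1: "4 * real (card F) \<le> real T * d\<^sup>2"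
    using d by (simp only: pos_divide_le_eq zero_less_power)
  obtain N where N: "\<And>a. 0 \<le> N a" "\<And>a. N a \<le> real T" "N X = real T"
      "\<And>a b. a \<inter> b = {} \<Longrightarrow> N (a \<union> b) = N a + N b"
      "(\<Sum>a\<in>F. (max 0 (real T * d - N a))\<^sup>2) \<le> real (card F) * real T"
    using charge_with_small_deficit[of F d X T] F d w by auto
  have "d / 2 \<le> N a / real T" if "a \<in> F" for a
  proof -
    have "(max 0 (real T * d - N a))\<^sup>2 \<le> (\<Sum>a\<in>F. (max 0 (real T * d - N a))\<^sup>2)"
      using F that by (intro member_le_sum) auto
    also note N(5)
    also have "real (card F) * real T \<le> (real T * d / 2)\<^sup>2"
    proof -
      have "(real T * d / 2)\<^sup>2 = real T * d\<^sup>2 * real T / 4"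
        by (simp add: power2_eq_square)
      then show ?thesis using mult_right_mono[OF T1, of "real T"] by simp
    qed
    finally have "max 0 (real T * d - N a) \<le> real T * d / 2"
      by (rule power2_le_imp_le) (use T0 d in auto)
    then have "real T * d / 2 \<le> N a" by linarith
    then show ?thesis using T0 by (simp add: field_simps)
  qed
  moreover have "(\<lambda>a. N a / real T) \<in> normalized_charges X B"
    using N T0 by (auto simp: normalized_charges_def divide_simps)
  ultimately show ?thesis by (intro bexI[of _ "\<lambda>a. N a / real T"]) auto
qed

text \<open>The bounds 0 and 1 hold at every set, inside \<open>B\<close> or not, which places the
  charges in a cube over all sets, compact by Tychonoff. Every other condition involves finitely
  many coordinates and is therefore closed.\<close>

lemma compact_normalized_charges: "compact (normalized_charges X B)"
proof -
  let ?U = "(UNIV :: 'a set set)"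
  have "compactin (product_topology (\<lambda>_. euclidean) ?U) (\<Pi>\<^sub>E _ \<in> ?U. {0..1::real})"
    by (subst compactin_PiE) auto
  then have K: "compact (\<Pi>\<^sub>E _ \<in> ?U. {0..1::real})"
    by (simp add: euclidean_product_topology)
  have cont: "continuous_on UNIV (\<lambda>\<mu> :: 'a set \<Rightarrow> real. \<mu> a)" for a
    by (rule continuous_on_product_coordinates)
  have "closed (normalized_charges X B)"
    unfolding normalized_charges_def Ball_def
    by (intro closed_Collect_conj closed_Collect_all closed_Collect_imp closed_Collect_le
        closed_Collect_eq open_Collect_const continuous_intros cont)
  moreover have "normalized_charges X B = (\<Pi>\<^sub>E _ \<in> ?U. {0..1}) \<inter> normalized_charges X B"
    by (auto simp: normalized_charges_def)
  ultimately show ?thesis using K compact_Int_closed by metis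
qed

text \<open>Finite intersection property of closed conditions; it works because the same
  \<open>e\<close> serves every finite \<open>F\<close>.\<close>

lemma normalized_charge_from_finite:
  fixes X :: "'a set" and C :: "'a set set" and e :: real
  assumes "\<And>F. finite F \<Longrightarrow> F \<subseteq> C \<Longrightarrow> \<exists>\<mu> \<in> normalized_charges X B. \<forall>a\<in>F. e \<le> \<mu> a"
  shows "\<exists>\<mu> \<in> normalized_charges X B. \<forall>a\<in>C. e \<le> \<mu> a"
proof -
  have "normalized_charges X B \<inter> (\<Inter>a\<in>C. {\<mu>. e \<le> \<mu> a}) \<noteq> {}"
  proof (rule compact_imp_fip_image[OF compact_normalized_charges])
    show "closed {\<mu> :: 'a set \<Rightarrow> real. e \<le> \<mu> a}" for a
      by (intro closed_Collect_le continuous_intros continuous_on_product_coordinates)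
    show "normalized_charges X B \<inter> (\<Inter>a\<in>F. {\<mu>. e \<le> \<mu> a}) \<noteq> {}" if "finite F" "F \<subseteq> C" for F
      using assms[OF that] by blast
  qed
  then show ?thesis by blast
qed

text \<open>Real weights are imitated by repetition: \<open>a\<close> occurs \<open>k a\<close>
  times, the ceiling of \<open>n * w a\<close>. Rounding costs at most \<open>card F\<close> in
  total, and \<open>n\<close> is so large that this is covered by giving up half of
  \<open>d\<close>.\<close>

lemma intersection_number_imp_weighted:
  fixes X :: "'a set" and C :: "'a set set" and d :: real
  assumes "X \<noteq> {}" and d: "0 < d"
    and C: "\<And>I (a :: 'a set \<times> nat \<Rightarrow> 'a set). finite I \<Longrightarrow> I \<noteq> {} \<Longrightarrow> a ` I \<subseteq> C \<Longrightarrow>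
      \<exists>x\<in>X. d * real (card I) \<le> real (card {i \<in> I. x \<in> a i})"
    and F: "finite F" "F \<subseteq> C" and w: "\<And>a. (0::real) \<le> w a"
  shows "\<exists>x\<in>X. d / 2 * sum w F \<le> (\<Sum>a\<in>F. w a * indicator a x)"
proof (cases "sum w F = 0")
  case True
  then show ?thesis using \<open>X \<noteq> {}\<close> w by (auto intro!: sum_nonneg)
next
  case False
  then have W: "0 < sum w F" using w by (simp add: sum_nonneg order_less_le)
  obtain n :: nat where n: "max 1 (real (card F) / (d / 2 * sum w F)) \<le> real n"
    using real_arch_simple by blast
  then have n0: "0 < real n" and n1: "real (card F) \<le> real n * (d / 2 * sum w F)"
    using d W by (auto simp: field_simps)
  define k where "k a = nat \<lceil>real n * w a\<rceil>" for a
  have k: "real n * w a \<le> real (k a)" "real (k a) \<le> real n * w a + 1" for a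
    unfolding k_def using w[of a] by (simp_all add: real_nat_ceiling_ge of_nat_nat)
  define I where "I = Sigma F (\<lambda>a. {..<k a})"
  have cardI: "real (card I) = (\<Sum>a\<in>F. real (k a))" using F by (simp add: I_def card_SigmaI)
  have le: "real n * sum w F \<le> real (card I)"
    unfolding cardI sum_distrib_left by (intro sum_mono k)
  have le_d: "real n * (d * sum w F) \<le> d * real (card I)"
    using mult_left_mono[OF le, of d] d by (simp only: mult_ac less_imp_le)
  from le have "I \<noteq> {}" using n0 W by (auto simp: not_le mult_le_0_iff)
  moreover have "finite I" "fst ` I \<subseteq> C" using F by (auto simp: I_def)
  ultimately obtain x where x: "x \<in> X" "d * real (card I) \<le> real (card {i \<in> I. x \<in> fst i})"
    using C by blast
  have "{i \<in> I. x \<in> fst i} = Sigma {a \<in> F. x \<in> a} (\<lambda>a. {..<k a})" by (auto simp: I_def)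
  then have "real (card {i \<in> I. x \<in> fst i}) = (\<Sum>a\<in>{a \<in> F. x \<in> a}. real (k a))"
    using F by (simp add: card_SigmaI)
  also have "\<dots> = (\<Sum>a\<in>F. real (k a) * indicator a x)"
    using F by (intro sum.mono_neutral_cong_left) auto
  also have "\<dots> \<le> (\<Sum>a\<in>F. real n * (w a * indicator a x) + 1)"
    using k(2) by (intro sum_mono) (auto split: split_indicator)
  also have "\<dots> = real n * (\<Sum>a\<in>F. w a * indicator a x) + real (card F)"
    by (simp add: sum.distrib sum_distrib_left)
  finally have "real n * (d * sum w F) \<le> real n * (\<Sum>a\<in>F. w a * indicator a x) + real n * (d / 2 * sum w F)"
    using x(2) n1 le_d by linarith
  then have "real n * (d / 2 * sum w F) \<le> real n * (\<Sum>a\<in>F. w a * indicator a x)"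
    by (simp add: algebra_simps)
  then have "d / 2 * sum w F \<le> (\<Sum>a\<in>F. w a * indicator a x)"
    using n0 by (simp only: mult_le_cancel_left_pos)
  with x(1) show ?thesis by blast
qed

lemma (in algebra) bounded_antichains_imp_charge:
  assumes "\<Omega> \<noteq> {}" "C \<subseteq> M" "D \<subseteq> positive_elements M"
    and "\<And>A. antichain M A \<Longrightarrow> A \<subseteq> D \<Longrightarrow> finite A \<and> card A \<le> K"
    and "\<And>h :: nat \<Rightarrow> 'a set. h ` {..<4} \<subseteq> M \<Longrightarrow> (\<Union>c<4. h c) \<in> C \<Longrightarrow> \<exists>c<4. h c \<in> D"
  obtains \<mu> e where "\<mu> \<in> normalized_charges \<Omega> M" "0 < e" "\<And>a. a \<in> C \<Longrightarrow> e \<le> \<mu> a"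
proof -
  define z where "z = 216 * (real (K + 1))\<^sup>2"
  have z: "1 \<le> z"
    using one_le_power[of "real (K + 1)" 2] unfolding z_def by linarith
  define d where "d = 1 / z"
  have d: "0 < d" "d / 2 \<le> 1"
    using z by (simp_all add: d_def)
  have 1: "\<exists>x\<in>\<Omega>. d * real (card I) \<le> real (card {i \<in> I. x \<in> a i})"
    if "finite I" "I \<noteq> {}" "a ` I \<subseteq> C" for I and a :: "'a set \<times> nat \<Rightarrow> 'a set"
  proof -
    from bounded_antichains_imp_intersection_number[OF assms(2,4,3,5) that]
    obtain x where "x \<in> \<Omega>" "card I \<le> 216 * (K + 1)\<^sup>2 * card {i \<in> I. x \<in> a i}"
      by blast
    then have "real (card I) \<le> real (216 * (K + 1)\<^sup>2 * card {i \<in> I. x \<in> a i})"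
      by (intro of_nat_mono)
    then have "real (card I) \<le> z * real (card {i \<in> I. x \<in> a i})"
      unfolding z_def by (simp only: of_nat_mult of_nat_power of_nat_numeral)
    then have "d * real (card I) \<le> real (card {i \<in> I. x \<in> a i})"
      using z by (simp add: d_def field_simps)
    with \<open>x \<in> \<Omega>\<close> show ?thesis by blast
  qed
  \<comment> \<open>One halving of \<open>d\<close> pays for rounding the weights, the other for the
    deficits that remain after finitely many rounds.\<close>
  have "\<exists>\<mu> \<in> normalized_charges \<Omega> M. \<forall>a\<in>C. d / 2 / 2 \<le> \<mu> a"
  proof (rule normalized_charge_from_finite, rule normalized_charge_on_finite)
    show "\<exists>x\<in>\<Omega>. d / 2 * sum w F \<le> (\<Sum>a\<in>F. w a * indicator a x)"
      if "finite F" "F \<subseteq> C" "\<And>a. 0 \<le> w a" for F and w :: "'a set \<Rightarrow> real"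
      using intersection_number_imp_weighted[OF assms(1) d(1) 1] that by blast
  qed (use d in auto)
  then show ?thesis using that d by (metis half_gt_zero)
qed

section \<open>The countably additive part of a charge\<close>

lemma antichain_subset: "antichain B A \<Longrightarrow> A' \<subseteq> A \<Longrightarrow> antichain B A'"
  by (simp add: antichain_def subset_eq)

lemma antichain_insert:
  assumes "antichain B A" "a \<in> B" "a \<noteq> {}" "\<And>b. b \<in> A \<Longrightarrow> a \<inter> b = {}"
  shows "antichain B (insert a A)"
proof -
  have "a \<in> positive_elements B" using assms by (simp add: positive_elements_def)
  with assms(1,4) show ?thesis unfolding antichain_def by blast
qed

locale strictly_positive_charge = algebra +
  fixes m :: "'a set \<Rightarrow> real"
  assumes nonneg: "0 \<le> m a"
    and additive: "a \<in> M \<Longrightarrow> b \<in> M \<Longrightarrow> a \<inter> b = {} \<Longrightarrow> m (a \<union> b) = m a + m b"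
    and positive: "a \<in> M \<Longrightarrow> a \<noteq> {} \<Longrightarrow> 0 < m a"
begin

lemma charge_empty [simp]: "m {} = 0"
  using additive[of "{}" "{}"] by simp

lemma charge_mono:
  assumes "a \<in> M" "b \<in> M" "a \<subseteq> b"
  shows "m a \<le> m b"
proof -
  have "m (a \<union> (b - a)) = m a + m (b - a)"
    using assms by (intro additive) auto
  moreover have "a \<union> (b - a) = b" using assms by auto
  ultimately show ?thesis using nonneg[of "b - a"] by simp
qed

lemma charge_Un_le:
  assumes "a \<in> M" "b \<in> M"
  shows "m (a \<union> b) \<le> m a + m b"
proof -
  have "m (a \<union> (b - a)) = m a + m (b - a)"
    using assms by (intro additive) auto
  moreover have "a \<union> (b - a) = a \<union> b" by auto
  moreover have "m (b - a) \<le> m b" using assms by (intro charge_mono) auto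
  ultimately show ?thesis by simp
qed

lemma charge_UN_le:
  fixes N :: nat
  assumes "range A \<subseteq> M"
  shows "m (\<Union>n<N. A n) \<le> (\<Sum>n<N. m (A n))"
proof (induction N)
  case (Suc N)
  have "m (A N \<union> (\<Union>n<N. A n)) \<le> m (A N) + m (\<Union>n<N. A n)"
    using assms by (intro charge_Un_le finite_UN) auto
  with Suc show ?case by (simp add: lessThan_Suc)
qed simp

text \<open>That \<^term>\<open>a\<close> lies below the supremum of \<^term>\<open>A\<close>, phrased so that the supremum need
  not exist and restriction to smaller elements is trivial.\<close>

definition covers :: "'a set \<Rightarrow> (nat \<Rightarrow> 'a set) \<Rightarrow> bool" where
  "covers a A \<longleftrightarrow> range A \<subseteq> M \<and> (\<forall>u\<in>M. u \<subseteq> a \<longrightarrow> (\<forall>n. u \<inter> A n = {}) \<longrightarrow> u = {})"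

text \<open>For a charge on a Boolean \<open>\<sigma>\<close>-algebra this is its countably additive part.\<close>

definition regularization :: "'a set \<Rightarrow> ennreal" where
  "regularization a = (INF A\<in>Collect (covers a). \<Sum>n. ennreal (m (A n)))"

lemma covers_sets: "covers a A \<Longrightarrow> A n \<in> M"
  by (auto simp: covers_def)

lemma coversD:
  assumes "covers a A" "u \<in> M" "u \<subseteq> a" "\<And>n. u \<inter> A n = {}"
  shows "u = {}"
  using assms by (simp add: covers_def)

lemma covers_subset: "covers b A \<Longrightarrow> a \<subseteq> b \<Longrightarrow> covers a A"
  by (auto simp: covers_def)

text \<open>A part \<open>u\<close> of \<open>s\<close> that misses every \<open>A n\<close> could
  be removed from \<open>s\<close>, leaving a smaller upper bound.\<close>

lemma covers_supremum:
  assumes "range A \<subseteq> M" "is_supremum M (range A) s"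
  shows "covers s A"
  unfolding covers_def
proof (intro conjI ballI impI)
  fix u assume u: "u \<in> M" "u \<subseteq> s" "\<forall>n. u \<inter> A n = {}"
  have "s - u \<in> M" "\<forall>a\<in>range A. a \<subseteq> s - u"
    using u assms by (auto simp: is_supremum_def)
  then have "s \<subseteq> s - u" using assms(2) by (auto simp: is_supremum_def)
  with u show "u = {}" by blast
qed (fact assms)

lemma regularization_le:
  "covers a A \<Longrightarrow> regularization a \<le> (\<Sum>n. ennreal (m (A n)))"
  unfolding regularization_def by (rule INF_lower) simp

lemma regularization_mono: "a \<subseteq> b \<Longrightarrow> regularization a \<le> regularization b"
  unfolding regularization_def using covers_subset by (intro INF_superset_mono) auto

lemma regularization_le_charge:
  assumes "a \<in> M"
  shows "regularization a \<le> ennreal (m a)"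
proof -
  let ?A = "\<lambda>n::nat. if n = 0 then a else {}"
  have "covers a ?A" using assms by (auto simp: covers_def split: if_splits)
  then have "regularization a \<le> (\<Sum>n. ennreal (m (?A n)))" by (rule regularization_le)
  also have "\<dots> = (\<Sum>n\<in>{0}. ennreal (m (?A n)))" by (rule suminf_finite) auto
  finally show ?thesis by simp
qed

lemma regularization_finite: "a \<in> M \<Longrightarrow> regularization a < top"
  using regularization_le_charge[of a] by (simp add: le_less_trans)

text \<open>The usual argument for outer measures merges covers with summable excess. What has to be
  checked is that covering is transitive: a part of \<open>s\<close> that misses every
  \<open>A n k\<close> also misses every \<open>a n\<close>, hence is empty.\<close>

lemma regularization_subadditive:
  assumes "covers s a"
  shows "regularization s \<le> (\<Sum>n. regularization (a n))"
proof (rule ennreal_le_epsilon)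
  fix e :: real assume e: "0 < e"
  have aM: "a n \<in> M" for n by (rule covers_sets[OF assms])
  have "\<exists>A. covers (a n) A \<and> (\<Sum>k. ennreal (m (A k))) \<le> regularization (a n) + ennreal (e * (1/2) ^ Suc n)" for n
  proof -
    \<comment> \<open>The increase is strict because the value is finite, and so the infimum yields
      a cover below it.\<close>
    have "regularization (a n) < regularization (a n) + ennreal (e * (1/2) ^ Suc n)"
      using ennreal_add_left_cancel_less[of "regularization (a n)" 0 "ennreal (e * (1/2) ^ Suc n)"]
        e regularization_finite[OF aM] by (simp add: less_top)
    then obtain A where "covers (a n) A" "(\<Sum>k. ennreal (m (A k))) < regularization (a n) + ennreal (e * (1/2) ^ Suc n)"
      unfolding regularization_def INF_less_iff by auto
    then show ?thesis by (auto intro: less_imp_le)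
  qed
  then obtain A where A: "\<And>n. covers (a n) (A n)"
    "\<And>n. (\<Sum>k. ennreal (m (A n k))) \<le> regularization (a n) + ennreal (e * (1/2) ^ Suc n)"
    by metis
  define D where "D i = (case prod_decode i of (n, k) \<Rightarrow> A n k)" for i
  have "covers s D"
    unfolding covers_def
  proof (intro conjI ballI impI)
    show "range D \<subseteq> M"
      using covers_sets[OF A(1)] by (auto simp: D_def split: prod.split)
    fix u assume u: "u \<in> M" "u \<subseteq> s" "\<forall>i. u \<inter> D i = {}"
    have "u \<inter> A n k = {}" for n k
      using u(3)[rule_format, of "prod_encode (n, k)"] by (simp add: D_def)
    then have "u \<inter> a n \<inter> A n k = {}" for n k by blast
    then have "u \<inter> a n = {}" for n
      using coversD[OF A(1)[of n] Int[OF u(1) aM]] by blast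
    then show "u = {}" using coversD[OF assms u(1,2)] by blast
  qed
  then have "regularization s \<le> (\<Sum>i. ennreal (m (D i)))" by (rule regularization_le)
  also have "\<dots> = (\<Sum>i. (\<lambda>(n, k). ennreal (m (A n k))) (prod_decode i))"
    by (simp add: D_def case_prod_unfold)
  also have "\<dots> = (\<Sum>n. \<Sum>k. ennreal (m (A n k)))"
    by (rule suminf_ennreal_2dimen) simp
  also have "\<dots> \<le> (\<Sum>n. regularization (a n) + ennreal (e * (1/2) ^ Suc n))"
    by (intro suminf_le A(2)) auto
  also have "\<dots> = (\<Sum>n. regularization (a n)) + (\<Sum>n. ennreal (e * (1/2) ^ Suc n))"
    by (intro suminf_add[symmetric]) auto
  also have "(\<lambda>n. e * (1/2) ^ Suc n) sums e"
    using sums_mult[OF power_half_series, of e] by simp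
  then have "(\<Sum>n. ennreal (e * (1/2) ^ Suc n)) = ennreal e"
    using e by (intro suminf_ennreal_eq) auto
  finally show "regularization s \<le> (\<Sum>n. regularization (a n)) + ennreal e" .
qed

text \<open>Cutting a cover of the union by \<open>a\<close> and by \<open>b\<close> gives covers of
  both whose terms add up to at most the original ones.\<close>

lemma regularization_superadditive:
  assumes "a \<in> M" "b \<in> M" "a \<inter> b = {}"
  shows "regularization a + regularization b \<le> regularization (a \<union> b)"
  unfolding regularization_def[of "a \<union> b"]
proof (rule INF_greatest)
  fix A assume "A \<in> Collect (covers (a \<union> b))"
  then have A: "covers (a \<union> b) A" "A n \<in> M" for n by (auto simp: covers_def)
  have restr: "covers c (\<lambda>n. A n \<inter> c)" if "c \<in> M" "c \<subseteq> a \<union> b" for c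
    unfolding covers_def
  proof (intro conjI ballI impI)
    show "range (\<lambda>n. A n \<inter> c) \<subseteq> M" using A(2) that by auto
    fix u assume u: "u \<in> M" "u \<subseteq> c" "\<forall>n. u \<inter> (A n \<inter> c) = {}"
    then have "u \<inter> A n = {}" for n by blast
    then show "u = {}"
      using coversD[OF A(1) u(1) order_trans[OF u(2) that(2)]] by blast
  qed
  have "regularization a + regularization b \<le> (\<Sum>n. ennreal (m (A n \<inter> a))) + (\<Sum>n. ennreal (m (A n \<inter> b)))"
    using assms by (intro add_mono regularization_le restr) auto
  also have "\<dots> = (\<Sum>n. ennreal (m (A n \<inter> a)) + ennreal (m (A n \<inter> b)))"
    by (intro suminf_add) auto
  also have "\<dots> \<le> (\<Sum>n. ennreal (m (A n)))"
  proof (intro suminf_le)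
    fix n
    have "m (A n \<inter> a) + m (A n \<inter> b) = m ((A n \<inter> a) \<union> (A n \<inter> b))"
      using assms A(2) by (intro additive[symmetric]) auto
    also have "\<dots> \<le> m (A n)"
      using assms A(2) by (intro charge_mono) auto
    finally show "ennreal (m (A n \<inter> a)) + ennreal (m (A n \<inter> b)) \<le> ennreal (m (A n))"
      by (simp add: nonneg ennreal_leI flip: ennreal_plus)
  qed auto
  finally show "regularization a + regularization b \<le> (\<Sum>n. ennreal (m (A n)))" .
qed

lemma regularization_empty [simp]: "regularization {} = 0"
  using regularization_le_charge[of "{}"] by simp

text \<open>One inequality goes through the finite unions, which lie below \<open>s\<close>; the
  other uses that \<open>s\<close> is the least upper bound, by way of
  \<open>covers_supremum\<close>.\<close>

lemma regularization_suminf: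
  assumes "range a \<subseteq> M" "disjoint_family a" "is_supremum M (range a) s"
  shows "(\<Sum>n. regularization (a n)) = regularization s"
proof (rule antisym)
  have fin: "(\<Sum>n<N. regularization (a n)) \<le> regularization (\<Union>n<N. a n)" for N
  proof (induction N)
    case (Suc N)
    have "a N \<inter> a n = {}" if "n < N" for n
      using assms(2) that by (simp add: disjoint_family_on_def)
    then have "a N \<inter> (\<Union>n<N. a n) = {}" by blast
    then have "regularization (a N) + regularization (\<Union>n<N. a n) \<le> regularization (a N \<union> (\<Union>n<N. a n))"
      using assms(1) by (intro regularization_superadditive finite_UN) auto
    with Suc show ?case by (simp add: lessThan_Suc add.commute) (meson add_left_mono order_trans)
  qed simp
  have sub: "(\<Union>n<N. a n) \<subseteq> s" for N
    using assms(3) by (auto simp: is_supremum_def)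
  have "(\<Sum>n<N. regularization (a n)) \<le> regularization s" for N
    by (rule order_trans[OF fin regularization_mono[OF sub]])
  then show "(\<Sum>n. regularization (a n)) \<le> regularization s"
    by (intro suminf_le_const) auto
  show "regularization s \<le> (\<Sum>n. regularization (a n))"
    using assms by (intro regularization_subadditive covers_supremum)
qed

lemma regularization_add:
  assumes "a \<in> M" "b \<in> M" "a \<inter> b = {}"
  shows "regularization (a \<union> b) = regularization a + regularization b"
proof (rule antisym)
  let ?A = "\<lambda>n::nat. if n = 0 then a else if n = 1 then b else {}"
  have "covers (a \<union> b) ?A"
    unfolding covers_def
  proof (intro conjI ballI impI)
    fix u assume "u \<subseteq> a \<union> b" and u: "\<forall>n. u \<inter> ?A n = {}"
    then show "u = {}" using u[rule_format, of 0] u[rule_format, of 1] by auto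
  qed (use assms in \<open>auto split: if_splits\<close>)
  then have "regularization (a \<union> b) \<le> (\<Sum>n. regularization (?A n))"
    by (rule regularization_subadditive)
  also have "\<dots> = (\<Sum>n\<in>{0, 1}. regularization (?A n))"
    by (rule suminf_finite) auto
  finally show "regularization (a \<union> b) \<le> regularization a + regularization b" by simp
qed (use assms regularization_superadditive in auto)

text \<open>A nonzero \<^term>\<open>a\<close> of regularization 0 has covers of arbitrarily small total charge; weak
  distributivity makes finite pieces of all of them cover one common nonzero part of \<^term>\<open>a\<close>.\<close>

lemma regularization_positive:
  assumes wd: "weakly_distributive M" and a: "a \<in> M" "a \<noteq> {}"
  shows "0 < regularization a"
proof (rule ccontr)
  assume "\<not> ?thesis"
  then have "regularization a = 0" by (simp add: not_less)
  then have "\<exists>A. covers a A \<and> (\<Sum>n. ennreal (m (A n))) < ennreal (1 / real (Suc k))" for k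
    using INF_less_iff[of "\<lambda>A. \<Sum>n. ennreal (m (A n))" "Collect (covers a)" "ennreal (1 / real (Suc k))"]
    unfolding regularization_def by (auto simp: ennreal_zero_less_divide)
  then obtain A where A: "\<And>k. covers a (A k)"
    "\<And>k. (\<Sum>n. ennreal (m (A k n))) < ennreal (1 / real (Suc k))" by metis
  have AM: "A k n \<in> M" for k n by (rule covers_sets[OF A(1)])
  define B where "B k = disjointed (\<lambda>n. A k n \<inter> a)" for k
  have BM: "B k n \<in> M" for k n
    using range_disjointed_sets[of "\<lambda>n. A k n \<inter> a"] AM a unfolding B_def by auto
  have B_sub: "B k n \<subseteq> A k n \<inter> a" for k n
    unfolding B_def by (rule disjointed_subset)
  have B_disj: "B k i \<inter> B k j = {}" if "i \<noteq> j" for k i j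
    using disjoint_family_disjointed[of "\<lambda>n. A k n \<inter> a"] that by (auto simp: B_def disjoint_family_on_def)
  have B_ex: "\<exists>i. x \<in> B k i" if "x \<in> A k n" "x \<in> a" for x k n
    using UN_disjointed_eq[of "\<lambda>n. A k n \<inter> a"] that unfolding B_def by blast
  \<comment> \<open>The complement of \<open>a\<close> completes the disjoint pieces to a partition:
    an element disjoint from all of them lies in \<open>a\<close> and misses the whole cover
    \<open>A k\<close>. Empty pieces are dropped because antichains consist of nonzero
    elements.\<close>
  define W where "W k = (range (B k) \<union> {\<Omega> - a}) - {{}}" for k
  have "partition_of_unit M (W k)" for k
    unfolding partition_of_unit_def
  proof (intro conjI allI impI)
    show "antichain M (W k)"
      unfolding antichain_def
    proof (intro conjI ballI impI)
      show "W k \<subseteq> positive_elements M"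
        using BM a by (auto simp: W_def positive_elements_def)
      have B_out: "B k i \<inter> (\<Omega> - a) = {}" for i using B_sub[of k i] by blast
      fix w w' assume w: "w \<in> W k" "w' \<in> W k" "w \<noteq> w'"
      consider i j where "w = B k i" "w' = B k j" | i where "w = B k i" "w' = \<Omega> - a"
        | i where "w' = B k i" "w = \<Omega> - a"
        using w by (auto simp: W_def)
      then show "w \<inter> w' = {}"
      proof cases
        case (1 i j)
        with w have "i \<noteq> j" by auto
        with 1 B_disj show ?thesis by simp
      qed (use B_out in \<open>simp_all add: Int_commute\<close>)
    qed
    fix Z assume Z: "antichain M Z \<and> W k \<subseteq> Z"
    show "Z = W k"
    proof (rule ccontr)
      assume "Z \<noteq> W k"
      with Z obtain z where z: "z \<in> Z" "z \<notin> W k" by auto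
      with Z have zM: "z \<in> M" "z \<noteq> {}" by (auto simp: antichain_def positive_elements_def)
      have dis: "z \<inter> w = {}" if "w \<in> range (B k) \<union> {\<Omega> - a}" for w
      proof (cases "w = {}")
        case False
        then have "w \<in> W k" using that by (simp add: W_def)
        then have "w \<in> Z" "z \<noteq> w" using z Z by blast+
        then show ?thesis using Z z(1) by (simp add: antichain_def)
      qed simp
      then have "z \<subseteq> a" using zM sets_into_space[of z] by blast
      moreover have "z \<inter> A k n = {}" for n
      proof (rule ccontr)
        assume "z \<inter> A k n \<noteq> {}"
        then obtain x where x: "x \<in> z" "x \<in> A k n" by blast
        then obtain i where "x \<in> B k i" using B_ex \<open>z \<subseteq> a\<close> by blast
        with dis[of "B k i"] x(1) show False by blast
      qed
      ultimately show False using coversD[OF A(1)[of k] zM(1)] zM(2) by blast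
    qed
  qed
  then obtain V where V: "partition_of_unit M V" "\<And>v n. v \<in> V \<Longrightarrow> finite {w \<in> W n. v \<inter> w \<noteq> {}}"
    using wd[unfolded weakly_distributive_def, rule_format, of W] by blast
  have "\<exists>v\<in>V. v \<inter> a \<noteq> {}"
  proof (rule ccontr)
    assume no: "\<not> ?thesis"
    have "antichain M V" and max: "\<And>Z. antichain M Z \<Longrightarrow> V \<subseteq> Z \<Longrightarrow> Z = V"
      using V(1) by (auto simp: partition_of_unit_def)
    then have "antichain M (insert a V)"
      using no a by (intro antichain_insert) auto
    then have "insert a V = V" using max by blast
    with no a show False by blast
  qed
  then obtain v where v: "v \<in> V" "v \<inter> a \<noteq> {}" by blast
  define u where "u = v \<inter> a"
  have "V \<subseteq> positive_elements M"
    using V(1) by (simp add: partition_of_unit_def antichain_def)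
  then have uM: "u \<in> M" "u \<subseteq> a"
    using v(1) a by (auto simp: u_def positive_elements_def)
  have "m u \<le> 1 / real (Suc k)" for k
  proof -
    define S where "S = {n. u \<inter> B k n \<noteq> {}}"
    have "B k ` S \<subseteq> {w \<in> W k. v \<inter> w \<noteq> {}}"
      by (auto simp: S_def W_def u_def)
    then have "finite (B k ` S)" using V(2)[OF v(1)] finite_subset by blast
    moreover have "inj_on (B k) S"
    proof (intro inj_onI, rule ccontr)
      fix i j assume "i \<in> S" "j \<in> S" "B k i = B k j" "i \<noteq> j"
      then show False using B_disj[of i j k] by (auto simp: S_def)
    qed
    ultimately have "finite S" by (rule finite_imageD)
    then obtain N where N: "S \<subseteq> {..<N}" using finite_nat_iff_bounded by blast
    \<comment> \<open>Only pieces with index below \<open>N\<close> meet \<open>u\<close>, so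
      \<open>u - U\<close> misses every \<open>A k n\<close> and vanishes. Covering has thus become
      inclusion in a finite union, to which finite subadditivity applies.\<close>
    define U where "U = (\<Union>n<N. A k n)"
    have UM: "U \<in> M" unfolding U_def using AM by auto
    have "(u - U) \<inter> A k n = {}" for n
    proof (rule ccontr)
      assume "(u - U) \<inter> A k n \<noteq> {}"
      then obtain x where x: "x \<in> u" "x \<notin> U" "x \<in> A k n" by blast
      then obtain i where i: "x \<in> B k i" using B_ex uM by blast
      then have "i < N" using x N by (auto simp: S_def)
      then show False using i x B_sub by (auto simp: U_def)
    qed
    then have "u - U = {}"
      using coversD[OF A(1)[of k] Diff[OF uM(1) UM]] uM(2) by blast
    then have "m u \<le> m U" using uM UM by (intro charge_mono) auto
    also have "\<dots> \<le> (\<Sum>n<N. m (A k n))"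
      unfolding U_def using AM by (intro charge_UN_le) auto
    finally have "ennreal (m u) \<le> (\<Sum>n<N. ennreal (m (A k n)))"
      by (simp add: nonneg ennreal_leI)
    also have "\<dots> \<le> (\<Sum>n. ennreal (m (A k n)))"
      by (rule sum_le_suminf) auto
    finally have "ennreal (m u) \<le> ennreal (1 / real (Suc k))"
      using A(2)[of k] by (simp add: le_less_trans less_imp_le)
    then show ?thesis by (subst (asm) ennreal_le_iff) auto
  qed
  moreover have "0 < m u" using positive[of u] uM v by (simp add: u_def)
  ultimately show False
    using reals_Archimedean[of "m u"] by (auto simp: inverse_eq_divide not_le[symmetric])
qed

lemma exists_boolean_measure:
  assumes "\<Omega> \<noteq> {}" "weakly_distributive M"
  shows "\<exists>\<mu>. boolean_measure \<Omega> M \<mu>"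
proof -
  define l where "l a = enn2real (regularization a)" for a
  have l: "ennreal (l a) = regularization a" "0 \<le> l a" if "a \<in> M" for a
    using regularization_finite[OF that] by (simp_all add: l_def)
  have l_pos: "0 < l a" if "a \<in> M" "a \<noteq> {}" for a
    using regularization_positive[OF assms(2) that] regularization_finite[OF that(1)]
    by (simp add: l_def enn2real_positive_iff)
  have l_mono: "l a \<le> l b" if "a \<in> M" "b \<in> M" "a \<subseteq> b" for a b
    unfolding l_def using regularization_mono[OF that(3)] regularization_finite[OF that(2)]
    by (rule enn2real_mono)
  have l_add: "l (a \<union> b) = l a + l b" if "a \<in> M" "b \<in> M" "a \<inter> b = {}" for a b
    unfolding l_def regularization_add[OF that]
    using that by (intro enn2real_plus regularization_finite)
  have l_sums: "(\<lambda>n. l (a n)) sums l s"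
    if "range a \<subseteq> M" "disjoint_family a" "is_supremum M (range a) s" for a :: "nat \<Rightarrow> 'a set" and s
  proof -
    have M: "a n \<in> M" "s \<in> M" for n using that by (auto simp: is_supremum_def)
    have "(\<lambda>n. regularization (a n)) sums regularization s"
      using regularization_suminf[OF that] by (metis summableI summable_sums)
    then have "(\<lambda>n. ennreal (l (a n))) sums ennreal (l s)"
      using M by (simp add: l)
    then show ?thesis using M l by (subst (asm) sums_ennreal) auto
  qed
  have "0 < l \<Omega>" using assms l_pos by simp
  then have "boolean_measure \<Omega> M (\<lambda>a. l a / l \<Omega>)"
    unfolding boolean_measure_def
    using l_pos l_mono l_add by (auto simp: l_def[of "{}"] divide_right_mono add_divide_distrib intro!: sums_divide l_sums)
  then show ?thesis by blast
qed

end

section \<open>The characterization\<close>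

lemma boolean_measure_imp_charge:
  assumes "algebra X B" "boolean_measure X B m"
  shows "strictly_positive_charge X B (\<lambda>a. if a \<in> B then m a else 0)"
proof -
  interpret algebra X B by fact
  show ?thesis
  proof
    \<comment> \<open>A measure may be negative outside \<open>B\<close>, while the locale asks for
      nonnegative values everywhere; hence the value 0 there.\<close>
    show "0 \<le> (if a \<in> B then m a else 0)" for a
      using assms(2) by (cases "a = {}") (auto simp: boolean_measure_def intro: less_imp_le)
  qed (use assms(2) in \<open>auto simp: boolean_measure_def\<close>)
qed

context strictly_positive_charge
begin

lemma charge_UN_disjoint:
  assumes "finite I" "A ` I \<subseteq> M" "\<And>i j. i \<in> I \<Longrightarrow> j \<in> I \<Longrightarrow> i \<noteq> j \<Longrightarrow> A i \<inter> A j = {}"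
  shows "m (\<Union>i\<in>I. A i) = (\<Sum>i\<in>I. m (A i))"
  using assms
proof (induction I rule: finite_induct)
  case (insert i I)
  have "m (A i \<union> (\<Union>i\<in>I. A i)) = m (A i) + m (\<Union>i\<in>I. A i)"
  proof (rule additive)
    have "A i \<inter> A j = {}" if "j \<in> I" for j
      using insert.prems(2)[of i j] insert.hyps that by auto
    then show "A i \<inter> (\<Union>i\<in>I. A i) = {}" by blast
  qed (use insert in auto)
  with insert show ?case by simp
qed simp

lemma charge_antichain_card:
  assumes "finite A" "antichain M A" "0 < e" "\<And>a. a \<in> A \<Longrightarrow> e \<le> m a"
  shows "real (card A) \<le> m \<Omega> / e"
proof -
  have AM: "A \<subseteq> M" using assms(2) by (auto simp: antichain_def positive_elements_def)
  have "real (card A) * e \<le> (\<Sum>a\<in>A. m a)"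
    using assms(4) sum_bounded_below[of A e m] by simp
  also have "\<dots> = m (\<Union>a\<in>A. a)"
    using assms(1,2) AM by (intro charge_UN_disjoint[symmetric]) (auto simp: antichain_def)
  also have "\<dots> \<le> m \<Omega>"
    using AM sets_into_space assms(1) by (intro charge_mono finite_UN) auto
  finally show ?thesis using assms(3) by (simp add: field_simps)
qed

lemma charge_antichain_finite:
  assumes "antichain M A" "0 < e" "\<And>a. a \<in> A \<Longrightarrow> e \<le> m a"
  shows "finite A"
proof (rule ccontr)
  assume "infinite A"
  then obtain A' where A': "A' \<subseteq> A" "finite A'" "card A' = Suc (nat \<lceil>m \<Omega> / e\<rceil>)"
    using infinite_arbitrarily_large by metis
  then have "antichain M A'" using assms(1) antichain_subset by blast
  then have "real (card A') \<le> m \<Omega> / e"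
    using A' assms by (intro charge_antichain_card) auto
  also have "\<dots> \<le> real (nat \<lceil>m \<Omega> / e\<rceil>)" by (rule real_nat_ceiling_ge)
  finally show False using A' by simp
qed

text \<open>The countable chain condition: it turns a partition into a sequence, to which countable
  additivity can be applied.\<close>

lemma antichain_countable:
  assumes "antichain M A"
  shows "countable A"
proof -
  have eq: "A = (\<Union>k. {a \<in> A. 1 / real (Suc k) \<le> m a})"
  proof (intro set_eqI iffI)
    fix a assume a: "a \<in> A"
    then have "0 < m a" using assms positive by (auto simp: antichain_def positive_elements_def)
    then obtain k where "1 / real (Suc k) < m a"
      using reals_Archimedean[of "m a"] by (auto simp: inverse_eq_divide)
    with a show "a \<in> (\<Union>k. {a \<in> A. 1 / real (Suc k) \<le> m a})" by (auto intro: less_imp_le)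
  qed auto
  have "finite {a \<in> A. 1 / real (Suc k) \<le> m a}" for k
    using assms by (intro charge_antichain_finite[of _ "1 / real (Suc k)"]) (auto simp: antichain_def)
  then show ?thesis
    by (subst eq) (intro countable_UN countableI_type countable_finite)
qed

end

text \<open>Zorn gives an antichain maximal among those inside \<open>D\<close>. It is maximal among
  all antichains, since a further element \<open>b\<close> would contain some \<open>a\<close> of
  \<open>D\<close> that could be added as well.\<close>

lemma (in algebra) dense_imp_partition:
  assumes "D \<subseteq> positive_elements M"
    and dense: "\<And>b. b \<in> M \<Longrightarrow> b \<noteq> {} \<Longrightarrow> \<exists>a\<in>D. a \<subseteq> b"
  shows "\<exists>V \<subseteq> D. partition_of_unit M V"
proof -
  let ?P = "{A. antichain M A \<and> A \<subseteq> D}"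
  have "\<exists>V\<in>?P. \<forall>A\<in>?P. V \<subseteq> A \<longrightarrow> A = V"
  proof (rule subset_Zorn_nonempty)
    show "?P \<noteq> {}" by (auto simp: antichain_def)
    fix \<C> assume c: "\<C> \<noteq> {}" "subset.chain ?P \<C>"
    then have P: "antichain M A" "A \<subseteq> D" if "A \<in> \<C>" for A
      using that by (auto simp: subset_chain_def)
    have dis: "a \<inter> b = {}" if ab: "a \<in> A" "A \<in> \<C>" "b \<in> A'" "A' \<in> \<C>" "a \<noteq> b" for a b A A'
    proof -
      have "A \<subseteq> A' \<or> A' \<subseteq> A" using c ab by (auto simp: subset_chain_def)
      then show ?thesis using P(1)[of A] P(1)[of A'] ab unfolding antichain_def by blast
    qed
    have "antichain M (\<Union>\<C>)"
      unfolding antichain_def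
    proof (intro conjI ballI impI)
      show "\<Union>\<C> \<subseteq> positive_elements M"
        by (rule Union_least) (use P(1) in \<open>simp add: antichain_def\<close>)
      fix a b assume "a \<in> \<Union>\<C>" "b \<in> \<Union>\<C>" "a \<noteq> b"
      then show "a \<inter> b = {}" using dis by blast
    qed
    moreover have "\<Union>\<C> \<subseteq> D" by (rule Union_least) (rule P(2))
    ultimately show "\<Union>\<C> \<in> ?P" by simp
  qed
  then obtain V where V': "V \<in> ?P" "\<forall>A\<in>?P. V \<subseteq> A \<longrightarrow> A = V"
    by (elim bexE)
  then have V: "antichain M V" "V \<subseteq> D"
    and max: "\<And>A. antichain M A \<Longrightarrow> A \<subseteq> D \<Longrightarrow> V \<subseteq> A \<Longrightarrow> A = V" by simp_all
  have "A = V" if A: "antichain M A" "V \<subseteq> A" for A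
  proof (rule ccontr)
    assume "A \<noteq> V"
    with A obtain b where b: "b \<in> A" "b \<notin> V" by blast
    then have "b \<in> M" "b \<noteq> {}" using A(1) by (auto simp: antichain_def positive_elements_def)
    then obtain a where a: "a \<in> D" "a \<subseteq> b" using dense by blast
    have a0: "a \<in> M" "a \<noteq> {}" using a(1) assms(1) by (auto simp: positive_elements_def)
    have dis: "a \<inter> v = {}" if "v \<in> V" for v
    proof -
      have "v \<in> A" "b \<noteq> v" using b that A(2) by auto
      then have "b \<inter> v = {}" using b(1) A(1) by (simp add: antichain_def)
      with a show ?thesis by blast
    qed
    then have "antichain M (insert a V)"
      using V(1) a0 by (intro antichain_insert)
    then have "insert a V = V" using max a(1) V(2) by blast
    then have "a \<inter> a = {}" using dis by blast
    with a0 show False by simp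
  qed
  with V show ?thesis by (auto simp: partition_of_unit_def)
qed

text \<open>By \<open>dense_imp_partition\<close> it suffices that the elements with the finiteness
  property are dense. Below \<open>b\<close>, remove the supremum of what finite parts of all the
  partitions leave out; with leftovers small enough this costs at most half the measure of
  \<open>b\<close>, and the rest meets only members of the finite parts.\<close>

lemma boolean_measure_imp_weakly_distributive:
  assumes B: "boolean_sigma_algebra X B" and m: "boolean_measure X B m"
  shows "weakly_distributive B"
  unfolding weakly_distributive_def
proof (intro allI impI)
  fix W :: "nat \<Rightarrow> 'a set set" assume W: "\<forall>n. partition_of_unit B (W n)"
  have B': "boolean_algebra_of_sets X B" using B by (simp add: boolean_sigma_algebra_def)
  then have "algebra X B" by (simp add: boolean_algebra_of_sets_def)
  define m' where "m' a = (if a \<in> B then m a else 0)" for a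
  interpret strictly_positive_charge X B m'
    unfolding m'_def by (rule boolean_measure_imp_charge) fact+
  have sums: "(\<lambda>n. m' (a n)) sums m' s"
    if "range a \<subseteq> B" "disjoint_family a" "is_supremum B (range a) s" for a :: "nat \<Rightarrow> 'a set" and s
    using that m by (auto simp: boolean_measure_def m'_def is_supremum_def image_subset_iff)
  have W': "antichain B (W n)" "is_supremum B (W n) X" for n
    using W partition_of_unit_iff_supremum[OF B'] by auto
  have tail: "\<exists>F. finite F \<and> F \<subseteq> W n \<and> m' (X - \<Union>F) < e" if e: "0 < e" for n e
  proof -
    have cW: "countable (W n)" by (rule antichain_countable) (rule W')
    \<comment> \<open>The default \<open>{}\<close> pads a finite partition to a sequence; empty
      terms keep it disjoint and change neither the supremum nor the sum.\<close>
    define w where "w i = (if i \<in> to_nat_on (W n) ` W n then from_nat_into (W n) i else {})" for i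
    have w_range: "w i \<in> W n \<or> w i = {}" for i
      using cW by (auto simp: w_def)
    have wB: "w i \<in> B" for i
      using w_range[of i] W'(1)[of n] by (auto simp: antichain_def positive_elements_def)
    have w_surj: "\<exists>i. w i = a" if "a \<in> W n" for a
      using cW that by (intro exI[of _ "to_nat_on (W n) a"]) (simp add: w_def)
    have w_disj: "w i \<inter> w j = {}" if "i \<noteq> j" for i j
    proof (cases "i \<in> to_nat_on (W n) ` W n \<and> j \<in> to_nat_on (W n) ` W n")
      case True
      then obtain a b where ab: "a \<in> W n" "b \<in> W n" "i = to_nat_on (W n) a" "j = to_nat_on (W n) b" by blast
      with that have "a \<noteq> b" by blast
      with ab have "a \<inter> b = {}" using W'(1)[of n] by (auto simp: antichain_def)
      then show ?thesis using ab cW by (simp add: w_def)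
    qed (auto simp: w_def)
    have "is_supremum B (range w) X"
      using W'(2)[of n] w_range w_surj wB sets_into_space
      unfolding is_supremum_def by (metis (no_types, lifting) UNIV_I empty_subsetI image_iff)
    then have "(\<lambda>i. m' (w i)) sums m' X"
      using wB w_disj by (intro sums) (auto simp: disjoint_family_on_def)
    then have "(\<lambda>N. \<Sum>i<N. m' (w i)) \<longlonglongrightarrow> m' X" by (simp add: sums_def)
    then have "\<forall>\<^sub>F N in sequentially. m' X - e < (\<Sum>i<N. m' (w i))"
      using e by (intro order_tendstoD(1)) auto
    then obtain N where N: "m' X - e < (\<Sum>i<N. m' (w i))"
      by (auto simp: eventually_sequentially)
    let ?U = "\<Union>i<N. w i"
    have UB: "?U \<in> B" using wB by auto
    have "m' ?U = (\<Sum>i<N. m' (w i))"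
      using wB w_disj by (intro charge_UN_disjoint) auto
    moreover have "m' (?U \<union> (X - ?U)) = m' ?U + m' (X - ?U)"
      using UB by (intro additive) auto
    moreover have "?U \<union> (X - ?U) = X" using UB sets_into_space by auto
    ultimately have "m' (X - ?U) < e" using N by simp
    moreover have "\<Union>(w ` {..<N} - {{}}) = ?U" by auto
    moreover have "w ` {..<N} - {{}} \<subseteq> W n" using w_range by auto
    ultimately show ?thesis by (intro exI[of _ "w ` {..<N} - {{}}"]) auto
  qed
  define D where "D = {a \<in> positive_elements B. \<forall>n. finite {w \<in> W n. a \<inter> w \<noteq> {}}}"
  have "\<exists>a\<in>D. a \<subseteq> b" if b: "b \<in> B" "b \<noteq> {}" for b
  proof -
    have mb: "0 < m' b" using positive b by simp
    then have "\<exists>F. finite F \<and> F \<subseteq> W n \<and> m' (X - \<Union>F) < m' b / 2 * (1/2) ^ Suc n" for n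
      by (intro tail) simp
    then obtain F where F: "\<And>n. finite (F n)" "\<And>n. F n \<subseteq> W n"
      "\<And>n. m' (X - \<Union>(F n)) < m' b / 2 * (1/2) ^ Suc n" by metis
    define c where "c n = X - \<Union>(F n)" for n
    have FB: "\<Union>(F n) \<in> B" for n
      using F(1,2)[of n] W'(1)[of n] by (intro finite_Union) (auto simp: antichain_def positive_elements_def)
    then have cB: "c n \<in> B" for n by (auto simp: c_def)
    \<comment> \<open>The leftovers may overlap, while countable additivity concerns disjoint
      sequences. Making them disjoint keeps their union, so the supremum \<open>s\<close> still
      contains every \<open>c n\<close>.\<close>
    have dB: "range (disjointed c) \<subseteq> B" using cB by (intro range_disjointed_sets) auto
    obtain s where s: "is_supremum B (range (disjointed c)) s"
      using B dB unfolding boolean_sigma_algebra_def by blast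
    have sB: "s \<in> B" using s by (simp add: is_supremum_def)
    have cs: "c n \<subseteq> s" for n
    proof -
      have "(\<Union>n. disjointed c n) \<subseteq> s" using s by (auto simp: is_supremum_def)
      then show ?thesis unfolding UN_disjointed_eq by blast
    qed
    have s1: "(\<lambda>n. m' (disjointed c n)) sums m' s"
      by (rule sums[OF dB disjoint_family_disjointed s])
    have s2: "(\<lambda>n. m' b / 2 * (1/2) ^ Suc n) sums (m' b / 2)"
      using sums_mult[OF power_half_series, of "m' b / 2"] by simp
    have "m' (disjointed c n) \<le> m' b / 2 * (1/2) ^ Suc n" for n
      using charge_mono[of "disjointed c n" "c n"] dB cB disjointed_subset[of c n] F(3)[of n]
      unfolding c_def[symmetric] by (auto simp: image_subset_iff)
    then have "m' s \<le> m' b / 2" using s1 s2 by (rule sums_le)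
    then have "\<not> b \<subseteq> s" using charge_mono[OF b(1) sB] mb by auto
    then have pos: "b - s \<in> positive_elements B" using b sB by (auto simp: positive_elements_def)
    have "{w \<in> W n. (b - s) \<inter> w \<noteq> {}} \<subseteq> F n" for n
    proof
      fix w assume "w \<in> {w \<in> W n. (b - s) \<inter> w \<noteq> {}}"
      then obtain x where x: "w \<in> W n" "x \<in> b" "x \<notin> s" "x \<in> w" by blast
      then have "x \<in> \<Union>(F n)" using cs[of n] b sets_into_space by (auto simp: c_def)
      then obtain f where f: "f \<in> F n" "x \<in> f" by blast
      then have "f = w" using F(2)[of n] x W'(1)[of n] unfolding antichain_def by blast
      with f show "w \<in> F n" by simp
    qed
    then have "b - s \<in> D" using pos F(1) finite_subset unfolding D_def by blast
    then show ?thesis by blast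
  qed
  then obtain V where "V \<subseteq> D" "partition_of_unit B V"
    using dense_imp_partition[of D] by (auto simp: D_def)
  then show "\<exists>V. partition_of_unit B V \<and> (\<forall>a\<in>V. \<forall>n. finite {w \<in> W n. a \<inter> w \<noteq> {}})"
    by (auto simp: D_def)
qed

section \<open>From the two conditions to a measure\<close>

lemma weighted_series_strictly_positive_charge:
  fixes \<mu> :: "nat \<Rightarrow> 'a set \<Rightarrow> real"
  assumes "algebra X B" "\<And>n. \<mu> n \<in> normalized_charges X B"
    and pos: "\<And>a. a \<in> B \<Longrightarrow> a \<noteq> {} \<Longrightarrow> \<exists>n. 0 < \<mu> n a"
  shows "strictly_positive_charge X B (\<lambda>a. \<Sum>n. \<mu> n a * (1/2) ^ n)"
proof -
  interpret algebra X B by fact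
  have \<mu>: "0 \<le> \<mu> n a" "\<mu> n a \<le> 1" for n a
    using assms(2)[of n] by (auto simp: normalized_charges_def)
  have add: "\<mu> n (a \<union> b) = \<mu> n a + \<mu> n b" if "a \<in> B" "b \<in> B" "a \<inter> b = {}" for n a b
    using assms(2)[of n] that by (auto simp: normalized_charges_def)
  have summ: "summable (\<lambda>n. \<mu> n a * (1/2) ^ n)" for a
  proof (rule summable_comparison_test')
    show "summable (\<lambda>n. (1/2::real) ^ n)" by (rule summable_geometric) simp
    show "norm (\<mu> n a * (1/2) ^ n) \<le> (1/2) ^ n" if "0 \<le> n" for n
      using \<mu>[of n a] by (simp add: mult_left_le_one_le)
  qed
  show ?thesis
  proof
    show "0 \<le> (\<Sum>n. \<mu> n a * (1/2) ^ n)" for a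
      using \<mu> by (intro suminf_nonneg summ) auto
    show "(\<Sum>n. \<mu> n (a \<union> b) * (1/2) ^ n) = (\<Sum>n. \<mu> n a * (1/2) ^ n) + (\<Sum>n. \<mu> n b * (1/2) ^ n)"
      if "a \<in> B" "b \<in> B" "a \<inter> b = {}" for a b
      by (simp only: add[OF that] distrib_right suminf_add[OF summ summ])
    show "0 < (\<Sum>n. \<mu> n a * (1/2) ^ n)" if a: "a \<in> B" "a \<noteq> {}" for a
    proof -
      obtain n where "0 < \<mu> n a" using pos a by blast
      then show ?thesis using \<mu> by (intro suminf_pos2[OF summ, of _ n]) auto
    qed
  qed
qed

theorem theorem1p4:
  fixes X :: "'a set" and B :: "'a set set"
  assumes "boolean_sigma_algebra X B"
  shows "measure_algebra X B \<longleftrightarrow>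
    weakly_distributive B \<and>
    (\<exists>C :: nat \<Rightarrow> 'a set set.
       (\<forall>n. C n \<subseteq> positive_elements B) \<and>
       positive_elements B = (\<Union>n. C n) \<and>
       (\<forall>n. \<exists>K :: nat. \<forall>A. antichain B A \<and> A \<subseteq> C n \<longrightarrow> finite A \<and> card A \<le> K) \<and>
       (\<forall>n. \<forall>a\<in>B. \<forall>b\<in>B. a \<union> b \<in> C n \<longrightarrow> a \<in> C (Suc n) \<or> b \<in> C (Suc n)))"
    (is "_ \<longleftrightarrow> _ \<and> (\<exists>C. ?fragmentation C)")
proof -
  have ne: "X \<noteq> {}" and alg: "algebra X B"
    using assms by (auto simp: boolean_sigma_algebra_def boolean_algebra_of_sets_def)
  interpret algebra X B by (rule alg)
  show ?thesis
  proof (intro iffI conjI)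
    assume "measure_algebra X B"
    then obtain m where m: "boolean_measure X B m" by (auto simp: measure_algebra_def)
    show "weakly_distributive B"
      by (rule boolean_measure_imp_weakly_distributive) fact+
    define m' where "m' a = (if a \<in> B then m a else 0)" for a
    interpret strictly_positive_charge X B m'
      unfolding m'_def by (rule boolean_measure_imp_charge) fact+
    define C where "C n = {a \<in> positive_elements B. (1/2) ^ n \<le> m' a}" for n
    have "\<exists>n. a \<in> C n" if "a \<in> positive_elements B" for a
    proof -
      have "0 < m' a" using that positive by (auto simp: positive_elements_def)
      then obtain n where "(1/2) ^ n < m' a"
        using real_arch_pow_inv[of "m' a" "1/2"] by auto
      with that show ?thesis by (auto simp: C_def intro: less_imp_le)
    qed
    then have 1: "positive_elements B = (\<Union>n. C n)" by (auto simp: C_def)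
    have 2: "finite A \<and> card A \<le> nat \<lceil>m' X / (1/2) ^ n\<rceil>" if A: "antichain B A" "A \<subseteq> C n" for A n
    proof -
      have "finite A"
        using A by (intro charge_antichain_finite[of A "(1/2) ^ n"]) (auto simp: C_def)
      moreover have "real (card A) \<le> m' X / (1/2) ^ n"
        using \<open>finite A\<close> A by (intro charge_antichain_card) (auto simp: C_def)
      ultimately show ?thesis by linarith
    qed
    have 3: "a \<in> C (Suc n) \<or> b \<in> C (Suc n)"
      if ab: "a \<in> B" "b \<in> B" "a \<union> b \<in> C n" for a b n
    proof -
      have "(1/2) ^ n \<le> m' a + m' b"
        using ab charge_Un_le[of a b] by (auto simp: C_def)
      then have "(1/2) ^ Suc n \<le> m' a \<or> (1/2) ^ Suc n \<le> m' b" by auto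
      moreover have "a \<noteq> {}" if "(1/2) ^ Suc n \<le> m' a" for a
      proof
        assume "a = {}"
        then have "(1/2) ^ Suc n \<le> (0::real)" using that charge_empty by simp
        moreover have "(0::real) < (1/2) ^ Suc n" by (rule zero_less_power) simp
        ultimately show False by linarith
      qed
      ultimately show ?thesis using ab by (auto simp: C_def positive_elements_def)
    qed
    have "\<forall>n. C n \<subseteq> positive_elements B" by (auto simp: C_def)
    moreover have "\<forall>n. \<exists>K. \<forall>A. antichain B A \<and> A \<subseteq> C n \<longrightarrow> finite A \<and> card A \<le> K"
      using 2 by blast
    moreover have "\<forall>n. \<forall>a\<in>B. \<forall>b\<in>B. a \<union> b \<in> C n \<longrightarrow> a \<in> C (Suc n) \<or> b \<in> C (Suc n)"
      using 3 by blast
    ultimately have "?fragmentation C" using 1 by (intro conjI)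
    then show "\<exists>C. ?fragmentation C" by (rule exI[of _ C])
  next
    assume R: "weakly_distributive B \<and> (\<exists>C. ?fragmentation C)"
    then have "\<exists>C. ?fragmentation C" by (rule conjunct2)
    then obtain C where frag: "?fragmentation C" by (rule exE)
    have C: "\<And>n. C n \<subseteq> positive_elements B" "positive_elements B = (\<Union>n. C n)"
      "\<And>n. \<exists>K :: nat. \<forall>A. antichain B A \<and> A \<subseteq> C n \<longrightarrow> finite A \<and> card A \<le> K"
      "\<And>n a b. a \<in> B \<Longrightarrow> b \<in> B \<Longrightarrow> a \<union> b \<in> C n \<Longrightarrow> a \<in> C (Suc n) \<or> b \<in> C (Suc n)"
      using frag by (simp_all, blast)
    \<comment> \<open>The lower bound on \<open>C n\<close> depends on \<open>n\<close>; only its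
      positivity is kept, which gives the weighted series a positive term at each nonzero
      element.\<close>
    have "\<exists>\<mu> \<in> normalized_charges X B. \<forall>a\<in>C n. 0 < \<mu> a" for n
    proof -
      obtain K where K: "\<And>A. antichain B A \<Longrightarrow> A \<subseteq> C (Suc (Suc n)) \<Longrightarrow> finite A \<and> card A \<le> K"
        using C(3)[of "Suc (Suc n)"] by blast
      have split: "\<exists>c<4. h c \<in> C (Suc (Suc n))"
        if h: "h ` {..<4} \<subseteq> B" "(\<Union>c<4. h c) \<in> C n" for h :: "nat \<Rightarrow> 'a set"
      proof -
        have hB: "h 0 \<in> B" "h 1 \<in> B" "h 2 \<in> B" "h 3 \<in> B" using h(1) by auto
        have parts: "{..<4::nat} = {0, 1, 2, 3}" by auto
        then have "(\<Union>c<4. h c) = (h 0 \<union> h 1) \<union> (h 2 \<union> h 3)" by auto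
        then have "h 0 \<union> h 1 \<in> C (Suc n) \<or> h 2 \<union> h 3 \<in> C (Suc n)"
          using h(2) hB C(4)[of "h 0 \<union> h 1" "h 2 \<union> h 3" n] by auto
        then have "\<exists>c\<in>{..<4}. h c \<in> C (Suc (Suc n))"
          unfolding parts using C(4)[OF hB(1,2)] C(4)[OF hB(3,4)] by blast
        then show ?thesis by blast
      qed
      have "C n \<subseteq> B" using C(1)[of n] by (auto simp: positive_elements_def)
      from bounded_antichains_imp_charge[OF ne this C(1) K split]
      obtain \<mu> e where "\<mu> \<in> normalized_charges X B" "0 < e" "\<And>a. a \<in> C n \<Longrightarrow> e \<le> \<mu> a"
        by blast
      then show ?thesis by (meson less_le_trans)
    qed
    then obtain \<mu> where \<mu>: "\<And>n. \<mu> n \<in> normalized_charges X B" "\<And>n a. a \<in> C n \<Longrightarrow> 0 < \<mu> n a"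
      by metis
    have "\<exists>n. 0 < \<mu> n a" if "a \<in> B" "a \<noteq> {}" for a
      using that C(2) \<mu>(2) by (auto simp: positive_elements_def)
    then interpret strictly_positive_charge X B "\<lambda>a. \<Sum>n. \<mu> n a * (1/2) ^ n"
      by (intro weighted_series_strictly_positive_charge alg \<mu>(1))
    show "measure_algebra X B"
      using exists_boolean_measure ne R assms by (simp add: measure_algebra_def)
  qed
qed

end
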